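(* Let $\mathbf{A}$ be an $n\times n$ matrix over $\mathbb{K}$ with $\mathbf{A}\in\mathsf{TP}$ and such that $A=\operatorname{val}(\mathbf{A})\in\mathsf{TP}^{\mathrm{trop}}$. Write the characteristic polynomial of $\mathbf{A}$ as $$\det(\lambda\mathbf{I}-\mathbf{A})=\lambda^n+\sum_{i=0}^{n-1}(-1)^{n-i}\boldsymbol{\alpha}_{n-i}\lambda^i,\qquad \boldsymbol{\alpha}_0=1,$$ let $\boldsymbol{\rho}_1>\dots>\boldsymbol{\rho}_n$ be the eigenvalues of $\mathbf{A}$, let $a_0,\dots,a_n$ be the coefficients of the tropical characteristic polynomial of $A$, and let $\eta_1\ge\dots\ge\eta_n$ be the tropical eigenvalues of $A$ counted with multiplicities. Then $$\operatorname{val}(\boldsymbol{\alpha}_k)=a_k\quad\text{for all }k\in\{0,1,\dots,n\},\qquad \operatorname{val}(\boldsymbol{\rho}_i)=\eta_i\quad\text{for all }i\in\{1,\dots,n\}.$$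
   Context: $\mathbb{K}$ is the field of generalized Puiseux series with real coefficients and real exponents: series $f=\sum_{k\ge 0}a_kt^{b_k}$ with $a_k\in\mathbb{R}$ and $(b_k)$ a finite sequence, or a strictly decreasing sequence of reals tending to $-\infty$. The valuation $\operatorname{val}(f)$ is the largest exponent with nonzero coefficient, $\operatorname{val}(0)=-\infty$; it is applied to matrices entrywise. $\mathbb{K}$ is a real closed field, ordered by declaring a nonzero series positive if the coefficient of its largest exponent is positive. $\mathsf{TP}$ is the set of matrices over $\mathbb{K}$ all of whose minors are positive; by the Gantmacher–Krein theorem (valid over real closed fields) an $n\times n$ matrix in $\mathsf{TP}$ has $n$ distinct positive eigenvalues in $\mathbb{K}$. $\mathbb{R}_{\max}=\mathbb{R}\cup\{-\infty\}$ with $a\oplus b=\max(a,b)$, $a\odot b=a+b$, $x^{\odot i}=ix$. For a $d\times d$ matrix $M$ over $\mathbb{R}_{\max}$, $\operatorname{per}(M)=\max_{\sigma\in S_d}\sum_iM_{i,\sigma(i)}$; the weight of $\sigma$ is $\sum_iM_{i,\sigma(i)}$. $\mathsf{TP}^{\mathrm{trop}}$ is the set of matrices with entries in $\mathbb{R}$ such that in every square submatrix (rows and columns in natural order) all permutations of maximum weight are even. The tropical characteristic polynomial of $A\in\mathbb{R}_{\max}^{n\times n}$ is $f_A(x)=\operatorname{per}(x\odot I\oplus A)=x^{\odot n}\oplus\bigoplus_{i=0}^{n-1}a_{n-i}\odot x^{\odot i}$, where $I$ is the tropical identity matrix ($0$ on the diagonal, $-\infty$ elsewhere), $a_0=0$,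 and $a_k$ is the maximum of the tropical permanents of all $k\times k$ principal submatrices of $A$. $\eta\in\mathbb{R}_{\max}$ is a tropical eigenvalue of $A$ if the maximum defining $f_A(\eta)$ is attained by at least two of the terms. The multiplicity of $\eta\neq-\infty$ is the difference between the right and left derivatives of $f_A$ at $\eta$; if $-\infty$ is a tropical eigenvalue, its multiplicity is the limit of the derivative of $f_A$ at $t$ as $t\to-\infty$. Counted with multiplicities, $A$ has exactly $n$ tropical eigenvalues. *)

theory Defs
  imports
    "Jordan_Normal_Form.Char_Poly"
    "Jordan_Normal_Form.DL_Submatrix"
    "HOL-Library.Extended_Real"
begin

section \<open>Generalized Puiseux series\<close>

text \<open>
  A series is represented by its coefficient function, which sends an exponent \<open>b\<close> to the
  coefficient of \<open>t^b\<close>.  The condition on the support says that it is finite or the range of a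
  strictly decreasing sequence tending to minus infinity; see \<open>left_finite_iff_sequence\<close> below.
\<close>

definition left_finite :: "(real \<Rightarrow> real) \<Rightarrow> bool" where
  "left_finite f \<longleftrightarrow> (\<forall>c. finite {b. f b \<noteq> 0 \<and> c \<le> b})"

lemma left_finiteD: "left_finite f \<Longrightarrow> finite {b. f b \<noteq> 0 \<and> c \<le> b}"
  by (simp add: left_finite_def)

lemma left_finite_iff_sequence:
  "left_finite f \<longleftrightarrow>
     finite {b. f b \<noteq> 0} \<or>
     (\<exists>e :: nat \<Rightarrow> real. (\<forall>k l. k < l \<longrightarrow> e l < e k) \<and> filterlim e at_bot sequentially \<and> {b. f b \<noteq> 0} = range e)"
proof
  assume lf: "left_finite f"
  define S where "S = {b. f b \<noteq> 0}"
  have fin: "finite {b \<in> S. c \<le> b}" for c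
    using left_finiteD[OF lf, of c] by (simp add: S_def)
  show "finite {b. f b \<noteq> 0} \<or>
     (\<exists>e :: nat \<Rightarrow> real. (\<forall>k l. k < l \<longrightarrow> e l < e k) \<and> filterlim e at_bot sequentially \<and> {b. f b \<noteq> 0} = range e)"
  proof (cases "finite S")
    case True
    then show ?thesis by (simp add: S_def)
  next
    case inf: False
    define r where "r b = card {y \<in> S. b < y}" for b
    have fin': "finite {y \<in> S. b < y}" for b
      by (rule finite_subset[OF _ fin[of b]]) auto
    have r_less: "r b < r a" if "a \<in> S" "b \<in> S" "a < b" for a b
      unfolding r_def using that by (intro psubset_card_mono fin') auto
    have r_le: "b \<le> a" if "a \<in> S" "b \<in> S" "r a \<le> r b" for a b
      using r_less[of a b] that by (meson leD not_le_imp_less)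
    have ex: "\<exists>b\<in>S. r b = k" for k
    proof -
      obtain X where X: "X \<subseteq> S" "finite X" "card X = Suc k"
        using infinite_arbitrarily_large[OF inf] by blast
      define m where "m = Min X"
      have Xne: "X \<noteq> {}" using X by auto
      have m: "m \<in> S" using X(1) Min_in[OF X(2) Xne] by (auto simp: m_def)
      define F where "F = {y \<in> S. m \<le> y}"
      have finF: "finite F" using fin by (simp add: F_def)
      have "X \<subseteq> F" using X Xne by (auto simp: F_def m_def)
      then have cF: "Suc k \<le> card F" using card_mono[OF finF] X by metis
      have inj: "inj_on r F"
        by (rule inj_onI) (metis (no_types, lifting) F_def mem_Collect_eq order_antisym order_refl r_le)
      have "r ` F \<subseteq> {..<card F}"
      proof
        fix k' assume "k' \<in> r ` F"
        then obtain y where y: "y \<in> F" "k' = r y" by auto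
        have "{z \<in> S. y < z} \<subset> F" using y by (auto simp: F_def)
        then have "r y < card F" unfolding r_def by (rule psubset_card_mono[OF finF])
        then show "k' \<in> {..<card F}" using y by simp
      qed
      moreover have "card (r ` F) = card {..<card F}" using card_image[OF inj] by simp
      ultimately have "r ` F = {..<card F}" by (intro card_subset_eq) auto
      then have "k \<in> r ` F" using cF by auto
      then show ?thesis by (auto simp: F_def)
    qed
    then obtain e where e: "\<And>k. e k \<in> S" "\<And>k. r (e k) = k" by metis
    have dec: "e l < e k" if "k < l" for k l
      using r_le[of "e k" "e l"] e that by (metis less_le nat_neq_iff)
    have 1: "(\<forall>k l. k < l \<longrightarrow> e l < e k)" by (auto simp: dec)
    have 2: "S = range e"
    proof
      show "S \<subseteq> range e"
      proof
        fix b assume b: "b \<in> S"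
        have "b = e (r b)" using r_le[of b "e (r b)"] r_le[of "e (r b)" b] e b by auto
        then show "b \<in> range e" by auto
      qed
    qed (use e in auto)
    have 3: "filterlim e at_bot sequentially"
      unfolding filterlim_at_bot
    proof
      fix Z
      have "finite (r ` {b \<in> S. Z \<le> b})" using fin by simp
      then obtain N where N: "\<forall>k \<in> r ` {b \<in> S. Z \<le> b}. k < N"
        using finite_nat_set_iff_bounded by blast
      have "e k \<le> Z" if "k \<ge> N" for k
      proof (rule ccontr)
        assume "\<not> e k \<le> Z"
        then have "r (e k) \<in> r ` {b \<in> S. Z \<le> b}" using e(1)[of k] by (intro imageI) simp
        then show False using N that e by auto
      qed
      then show "\<forall>\<^sub>F k in sequentially. e k \<le> Z" by (auto simp: eventually_sequentially)
    qed
    show ?thesis using 1 2 3 unfolding S_def by blast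
  qed
next
  assume "finite {b. f b \<noteq> 0} \<or>
     (\<exists>e :: nat \<Rightarrow> real. (\<forall>k l. k < l \<longrightarrow> e l < e k) \<and> filterlim e at_bot sequentially \<and> {b. f b \<noteq> 0} = range e)"
  then show "left_finite f"
  proof
    assume "finite {b. f b \<noteq> 0}"
    then show ?thesis unfolding left_finite_def by (auto intro: finite_subset[rotated])
  next
    assume "\<exists>e :: nat \<Rightarrow> real. (\<forall>k l. k < l \<longrightarrow> e l < e k) \<and> filterlim e at_bot sequentially \<and> {b. f b \<noteq> 0} = range e"
    then obtain e :: "nat \<Rightarrow> real" where e: "filterlim e at_bot sequentially" "{b. f b \<noteq> 0} = range e"
      by blast
    show ?thesis unfolding left_finite_def
    proof
      fix c
      have "\<forall>\<^sub>F k in sequentially. e k \<le> c - 1" using e(1) by (simp add: filterlim_at_bot)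
      then obtain N where N: "\<And>k. k \<ge> N \<Longrightarrow> e k \<le> c - 1" by (auto simp: eventually_sequentially)
      have "{b. f b \<noteq> 0 \<and> c \<le> b} \<subseteq> e ` {..<N}"
      proof
        fix b assume b: "b \<in> {b. f b \<noteq> 0 \<and> c \<le> b}"
        then obtain k where k: "b = e k" using e(2) by auto
        have "k < N" using N[of k] b k by (cases "k < N") auto
        then show "b \<in> e ` {..<N}" using k by auto
      qed
      then show "finite {b. f b \<noteq> 0 \<and> c \<le> b}" by (rule finite_subset) simp
    qed
  qed
qed

typedef puiseux = "{f :: real \<Rightarrow> real. left_finite f}"
  morphisms pcoeff Abs_puiseux
  by (rule exI[of _ "\<lambda>_. 0"]) (simp add: left_finite_def)

setup_lifting type_definition_puiseux

lemma left_finite_pcoeff: "left_finite (pcoeff f)"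
  using pcoeff[of f] by simp

lemma puiseux_eqI: "(\<And>b. pcoeff f b = pcoeff g b) \<Longrightarrow> f = g"
  by (simp add: pcoeff_inject[symmetric] ext)

lemma left_finite_bounded:
  assumes "left_finite f"
  obtains M where "\<And>b. f b \<noteq> 0 \<Longrightarrow> b \<le> M"
proof -
  have fin: "finite {b. f b \<noteq> 0 \<and> 0 \<le> b}" using assms by (rule left_finiteD)
  have "b \<le> Max (insert 0 {b. f b \<noteq> 0 \<and> 0 \<le> b})" if "f b \<noteq> 0" for b
  proof (cases "0 \<le> b")
    case True
    then show ?thesis using that fin by (intro Max_ge) auto
  next
    case False
    then have "b \<le> 0" by simp
    also have "0 \<le> Max (insert 0 {b. f b \<noteq> 0 \<and> 0 \<le> b})" using fin by (intro Max_ge) auto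
    finally show ?thesis .
  qed
  then show thesis by (rule that)
qed

subsection \<open>Ring structure\<close>

definition conv :: "(real \<Rightarrow> real) \<Rightarrow> (real \<Rightarrow> real) \<Rightarrow> real \<Rightarrow> real" where
  "conv f g c = (\<Sum>a \<in> {a. f a \<noteq> 0 \<and> g (c - a) \<noteq> 0}. f a * g (c - a))"

lemma conv_eq:
  assumes "finite F" "{a. f a \<noteq> 0 \<and> g (c - a) \<noteq> 0} \<subseteq> F"
  shows "conv f g c = (\<Sum>a\<in>F. f a * g (c - a))"
  unfolding conv_def by (rule sum.mono_neutral_left) (use assms in auto)

lemma conv_eq_bound:
  assumes "left_finite f" "\<And>b. g b \<noteq> 0 \<Longrightarrow> b \<le> M" "N \<le> c - M"
  shows "conv f g c = (\<Sum>a \<in> {a. f a \<noteq> 0 \<and> N \<le> a}. f a * g (c - a))"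
proof (rule conv_eq)
  show "{a. f a \<noteq> 0 \<and> g (c - a) \<noteq> 0} \<subseteq> {a. f a \<noteq> 0 \<and> N \<le> a}"
  proof safe
    fix a assume "g (c - a) \<noteq> 0"
    then have "c - a \<le> M" by (rule assms(2))
    then show "N \<le> a" using assms(3) by linarith
  qed
qed (use left_finiteD[OF assms(1)] in auto)

lemma conv_commute: "conv f g c = conv g f c"
  unfolding conv_def
  by (rule sum.reindex_bij_witness[of _ "\<lambda>a. c - a" "\<lambda>a. c - a"]) auto

lemma conv_nonzeroE:
  assumes "conv f g c \<noteq> 0"
  obtains a b where "f a \<noteq> 0" "g b \<noteq> 0" "c = a + b"
proof -
  have "{a. f a \<noteq> 0 \<and> g (c - a) \<noteq> 0} \<noteq> {}"
    using assms unfolding conv_def by (metis sum.empty)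
  then obtain a where "f a \<noteq> 0" "g (c - a) \<noteq> 0" by auto
  then show thesis using that[of a "c - a"] by simp
qed

lemma left_finite_conv:
  assumes "left_finite f" "left_finite g"
  shows "left_finite (conv f g)"
  unfolding left_finite_def
proof
  fix c
  obtain M where M: "\<And>b. f b \<noteq> 0 \<Longrightarrow> b \<le> M" using left_finite_bounded[OF assms(1)] by blast
  obtain N where N: "\<And>b. g b \<noteq> 0 \<Longrightarrow> b \<le> N" using left_finite_bounded[OF assms(2)] by blast
  have "{d. conv f g d \<noteq> 0 \<and> c \<le> d} \<subseteq>
      (\<lambda>(a, b). a + b) ` ({a. f a \<noteq> 0 \<and> c - N \<le> a} \<times> {b. g b \<noteq> 0 \<and> c - M \<le> b})"
  proof safe
    fix d assume "conv f g d \<noteq> 0" "c \<le> d"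
    then obtain a b where ab: "f a \<noteq> 0" "g b \<noteq> 0" "d = a + b" by (auto elim: conv_nonzeroE)
    then show "d \<in> (\<lambda>(a, b). a + b) ` ({a. f a \<noteq> 0 \<and> c - N \<le> a} \<times> {b. g b \<noteq> 0 \<and> c - M \<le> b})"
      using M[of a] N[of b] \<open>c \<le> d\<close> by (intro image_eqI[of _ _ "(a, b)"]) auto
  qed
  then show "finite {d. conv f g d \<noteq> 0 \<and> c \<le> d}"
    by (rule finite_subset) (intro finite_imageI finite_cartesian_product left_finiteD assms)
qed

lemma conv_assoc:
  assumes "left_finite f" "left_finite g" "left_finite h"
  shows "conv (conv f g) h d = conv f (conv g h) d"
proof -
  obtain M1 where M1: "\<And>b. f b \<noteq> 0 \<Longrightarrow> b \<le> M1" using left_finite_bounded[OF assms(1)] by blast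
  obtain M2 where M2: "\<And>b. g b \<noteq> 0 \<Longrightarrow> b \<le> M2" using left_finite_bounded[OF assms(2)] by blast
  obtain M3 where M3: "\<And>b. h b \<noteq> 0 \<Longrightarrow> b \<le> M3" using left_finite_bounded[OF assms(3)] by blast
  let ?F = "{a. f a \<noteq> 0 \<and> d - M2 - M3 \<le> a}"
  let ?H = "{a. h a \<noteq> 0 \<and> d - M1 - M2 \<le> a}"
  have fg: "b \<le> M1 + M2" if "conv f g b \<noteq> 0" for b
    using that M1 M2 by (auto elim!: conv_nonzeroE intro: add_mono)
  have gh: "b \<le> M2 + M3" if "conv g h b \<noteq> 0" for b
    using that M2 M3 by (auto elim!: conv_nonzeroE intro: add_mono)
  have "conv (conv f g) h d = conv h (conv f g) d" by (rule conv_commute)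
  also have "\<dots> = (\<Sum>c\<in>?H. h c * conv f g (d - c))"
    by (rule conv_eq_bound[OF assms(3) fg]) auto
  also have "\<dots> = (\<Sum>c\<in>?H. h c * (\<Sum>a\<in>?F. f a * g (d - c - a)))"
  proof (rule sum.cong[OF refl])
    fix c assume c: "c \<in> ?H"
    then have "conv f g (d - c) = (\<Sum>a\<in>?F. f a * g (d - c - a))"
      using M3[of c] by (intro conv_eq_bound[OF assms(1) M2]) auto
    then show "h c * conv f g (d - c) = h c * (\<Sum>a\<in>?F. f a * g (d - c - a))" by simp
  qed
  also have "\<dots> = (\<Sum>a\<in>?F. f a * (\<Sum>c\<in>?H. h c * g (d - a - c)))"
    unfolding sum_distrib_left
    by (subst sum.swap) (simp add: algebra_simps)
  also have "\<dots> = (\<Sum>a\<in>?F. f a * conv g h (d - a))"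
  proof (rule sum.cong[OF refl])
    fix a assume a: "a \<in> ?F"
    then have "conv h g (d - a) = (\<Sum>c\<in>?H. h c * g (d - a - c))"
      using M1[of a] by (intro conv_eq_bound[OF assms(3) M2]) auto
    then show "f a * (\<Sum>c\<in>?H. h c * g (d - a - c)) = f a * conv g h (d - a)"
      by (simp add: conv_commute[of g h])
  qed
  also have "\<dots> = conv f (conv g h) d"
    by (rule conv_eq_bound[OF assms(1) gh, symmetric]) auto
  finally show ?thesis .
qed

lemma conv_add_right:
  assumes "left_finite f" "left_finite g" "left_finite h"
  shows "conv f (\<lambda>b. g b + h b) c = conv f g c + conv f h c"
proof -
  obtain M2 where M2: "\<And>b. g b \<noteq> 0 \<Longrightarrow> b \<le> M2" using left_finite_bounded[OF assms(2)] by blast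
  obtain M3 where M3: "\<And>b. h b \<noteq> 0 \<Longrightarrow> b \<le> M3" using left_finite_bounded[OF assms(3)] by blast
  have M: "b \<le> max M2 M3" if "g b + h b \<noteq> 0" for b
    using that M2[of b] M3[of b] by (cases "g b = 0") auto
  let ?F = "{a. f a \<noteq> 0 \<and> c - max M2 M3 \<le> a}"
  have "conv f (\<lambda>b. g b + h b) c = (\<Sum>a\<in>?F. f a * (g (c - a) + h (c - a)))"
    by (rule conv_eq_bound[OF assms(1) M]) auto
  moreover have "conv f g c = (\<Sum>a\<in>?F. f a * g (c - a))"
    by (rule conv_eq_bound[OF assms(1) M2]) auto
  moreover have "conv f h c = (\<Sum>a\<in>?F. f a * h (c - a))"
    by (rule conv_eq_bound[OF assms(1) M3]) auto
  ultimately show ?thesis by (simp add: distrib_left sum.distrib)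
qed

lemma left_finite_single: "left_finite (\<lambda>b. if b = d then x else 0)"
  unfolding left_finite_def
  by (rule allI, rule finite_subset[of _ "{d}"]) auto

lemma conv_single: "conv (\<lambda>b. if b = d then x else 0) f c = x * f (c - d)"
  by (subst conv_eq[of "{d}"]) auto

lemma left_finite_add:
  assumes "left_finite f" "left_finite g" shows "left_finite (\<lambda>b. f b + g b)"
  unfolding left_finite_def
proof
  fix c
  show "finite {b. f b + g b \<noteq> 0 \<and> c \<le> b}"
    by (rule finite_subset[of _ "{b. f b \<noteq> 0 \<and> c \<le> b} \<union> {b. g b \<noteq> 0 \<and> c \<le> b}"])
       (use assms in \<open>auto simp: left_finite_def\<close>)
qed

lemma left_finite_uminus: "left_finite f \<Longrightarrow> left_finite (\<lambda>b. - f b)"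
  by (simp add: left_finite_def)

instantiation puiseux :: comm_ring_1
begin

lift_definition zero_puiseux :: puiseux is "\<lambda>_. 0" by (simp add: left_finite_def)
lift_definition one_puiseux :: puiseux is "\<lambda>b. if b = 0 then 1 else 0" by (rule left_finite_single)
lift_definition plus_puiseux :: "puiseux \<Rightarrow> puiseux \<Rightarrow> puiseux" is "\<lambda>f g b. f b + g b"
  by (rule left_finite_add)
lift_definition uminus_puiseux :: "puiseux \<Rightarrow> puiseux" is "\<lambda>f b. - f b"
  by (rule left_finite_uminus)
lift_definition minus_puiseux :: "puiseux \<Rightarrow> puiseux \<Rightarrow> puiseux" is "\<lambda>f g b. f b - g b"
  unfolding diff_conv_add_uminus by (intro left_finite_add left_finite_uminus)
lift_definition times_puiseux :: "puiseux \<Rightarrow> puiseux \<Rightarrow> puiseux" is conv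
  by (rule left_finite_conv)

instance
proof
  fix f g h :: puiseux
  note rep = zero_puiseux.rep_eq one_puiseux.rep_eq plus_puiseux.rep_eq uminus_puiseux.rep_eq
    minus_puiseux.rep_eq times_puiseux.rep_eq
  note lf = left_finite_pcoeff
  show "f * g * h = f * (g * h)"
    by (rule puiseux_eqI) (simp only: rep conv_assoc[OF lf lf lf])
  show "f * g = g * f"
    by (rule puiseux_eqI) (simp only: rep conv_commute[of "pcoeff f"])
  show "1 * f = f"
    by (rule puiseux_eqI) (simp only: rep conv_single diff_zero mult_1)
  show "(f + g) * h = f * h + g * h"
    by (rule puiseux_eqI)
       (simp only: rep conv_commute[of _ "pcoeff h"] conv_add_right[OF lf lf lf])
  have "pcoeff 0 0 \<noteq> pcoeff 1 0" by (simp add: rep)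
  then show "(0::puiseux) \<noteq> 1" by metis
  show "f + g + h = f + (g + h)" by (rule puiseux_eqI) (simp add: rep)
  show "f + g = g + f" by (rule puiseux_eqI) (simp add: rep)
  show "0 + f = f" by (rule puiseux_eqI) (simp add: rep)
  show "- f + f = 0" by (rule puiseux_eqI) (simp add: rep)
  show "f - g = f + - g" by (rule puiseux_eqI) (simp add: rep)
qed

end

lemmas pcoeff_simps [simp] =
  zero_puiseux.rep_eq one_puiseux.rep_eq plus_puiseux.rep_eq uminus_puiseux.rep_eq
  minus_puiseux.rep_eq

subsection \<open>Leading exponent and valuation\<close>

definition lead_exp :: "puiseux \<Rightarrow> real" where
  "lead_exp f = (GREATEST b. pcoeff f b \<noteq> 0)"

definition val :: "puiseux \<Rightarrow> ereal" where
  "val f = (if f = 0 then -\<infinity> else ereal (lead_exp f))"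

lemma lead_exp:
  assumes "f \<noteq> 0"
  shows "pcoeff f (lead_exp f) \<noteq> 0" and "pcoeff f b \<noteq> 0 \<Longrightarrow> b \<le> lead_exp f"
proof -
  obtain b0 where b0: "pcoeff f b0 \<noteq> 0" using assms puiseux_eqI[of f 0] by auto
  let ?F = "{b. pcoeff f b \<noteq> 0 \<and> b0 \<le> b}"
  have fin: "finite ?F" by (intro left_finiteD left_finite_pcoeff)
  have ne: "b0 \<in> ?F" using b0 by simp
  have 1: "pcoeff f (Max ?F) \<noteq> 0" using Max_in[OF fin] ne by blast
  have 2: "b \<le> Max ?F" if "pcoeff f b \<noteq> 0" for b
  proof (cases "b0 \<le> b")
    case True then show ?thesis using that fin by (intro Max_ge) auto
  next
    case False
    then have "b \<le> b0" by simp
    also have "b0 \<le> Max ?F" using fin ne by (intro Max_ge) auto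
    finally show ?thesis .
  qed
  have "lead_exp f = Max ?F" unfolding lead_exp_def
    by (rule Greatest_equality) (use 1 2 in auto)
  then show "pcoeff f (lead_exp f) \<noteq> 0" "pcoeff f b \<noteq> 0 \<Longrightarrow> b \<le> lead_exp f" using 1 2 by auto
qed

lemma lead_exp_eqI:
  assumes "pcoeff f d \<noteq> 0" "\<And>b. pcoeff f b \<noteq> 0 \<Longrightarrow> b \<le> d"
  shows "lead_exp f = d"
  unfolding lead_exp_def by (rule Greatest_equality) (use assms in auto)

lemma pcoeff_mult_lead:
  assumes "\<And>b. pcoeff f b \<noteq> 0 \<Longrightarrow> b \<le> d" "\<And>b. pcoeff g b \<noteq> 0 \<Longrightarrow> b \<le> e"
  shows "pcoeff (f * g) (d + e) = pcoeff f d * pcoeff g e"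
    and "pcoeff (f * g) b \<noteq> 0 \<Longrightarrow> b \<le> d + e"
proof -
  have "{a. pcoeff f a \<noteq> 0 \<and> pcoeff g (d + e - a) \<noteq> 0} \<subseteq> {d}"
    using assms(1) assms(2)[of "d + e - a" for a] by force
  then show "pcoeff (f * g) (d + e) = pcoeff f d * pcoeff g e"
    by (simp add: times_puiseux.rep_eq conv_eq[of "{d}"])
  show "pcoeff (f * g) b \<noteq> 0 \<Longrightarrow> b \<le> d + e"
    using assms by (auto simp: times_puiseux.rep_eq elim!: conv_nonzeroE intro: add_mono)
qed

subsection \<open>Field structure\<close>

lemma pcoeff_power_bound:
  assumes "\<And>b. pcoeff u b \<noteq> 0 \<Longrightarrow> b \<le> - d"
  shows "pcoeff (u ^ k) b \<noteq> 0 \<Longrightarrow> b \<le> - (real k * d)"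
proof (induction k arbitrary: b)
  case 0
  then show ?case by (auto split: if_splits)
next
  case (Suc k)
  have "b \<le> - d + - (real k * d)"
    by (rule pcoeff_mult_lead(2)[of u _ "u ^ k"]) (use assms Suc in auto)
  then show ?case by (simp add: algebra_simps)
qed

lemma pcoeff_sum: "pcoeff (sum f A) b = (\<Sum>x\<in>A. pcoeff (f x) b)"
  by (induction A rule: infinite_finite_induct) auto

text \<open>\<open>1 - u\<close> is inverted by the geometric series of \<open>u\<close>, each coefficient of which is a finite sum.\<close>

lemma one_minus_invertible:
  assumes u: "\<And>b. pcoeff u b \<noteq> 0 \<Longrightarrow> b \<le> - d" and d: "d > 0"
  shows "\<exists>g. (1 - u) * g = 1"
proof -
  define K where "K c = nat \<lceil>- c / d\<rceil> + 1" for c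
  have K: "pcoeff (u ^ k) b = 0" if "c \<le> b" "K c \<le> k" for k b c
  proof (rule ccontr)
    assume "pcoeff (u ^ k) b \<noteq> 0"
    then have "b \<le> - (real k * d)" using pcoeff_power_bound[of u d k b] u by blast
    then have "real k * d \<le> - c" using that by linarith
    then have "real k \<le> - c / d" using d by (simp add: field_simps)
    moreover have "- c / d < real (K c)" unfolding K_def by linarith
    ultimately show False using that by linarith
  qed
  define s where "s N = (\<Sum>k<N. u ^ k)" for N :: nat
  define h where "h c = pcoeff (s (K c)) c" for c
  have s_eq: "pcoeff (s N) b = pcoeff (s (K c)) b" if "c \<le> b" "K c \<le> N" for N b c
    unfolding s_def pcoeff_sum
    by (rule sum.mono_neutral_right) (use K that in auto)
  have h_eq: "h b = pcoeff (s (K c)) b" if "c \<le> b" for b c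
  proof -
    have "- b / d \<le> - c / d" using that d by (simp add: field_simps)
    then have "K b \<le> K c" unfolding K_def by (intro add_right_mono nat_mono ceiling_mono)
    then show ?thesis using s_eq[of b b "K c"] by (simp add: h_def)
  qed
  have lf: "left_finite h" unfolding left_finite_def
  proof
    fix c
    have "{b. h b \<noteq> 0 \<and> c \<le> b} = {b. pcoeff (s (K c)) b \<noteq> 0 \<and> c \<le> b}"
      using h_eq by auto
    then show "finite {b. h b \<noteq> 0 \<and> c \<le> b}" by (simp add: left_finiteD left_finite_pcoeff)
  qed
  define g where "g = Abs_puiseux h"
  have g: "pcoeff g = h" using lf by (simp add: g_def Abs_puiseux_inverse)
  have "(1 - u) * g = 1"
  proof (rule puiseux_eqI)
    fix c
    let ?p = "1 - u"
    have p: "a \<le> 0" if "pcoeff ?p a \<noteq> 0" for a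
      using that u[of a] d by (auto split: if_splits)
    have cut: "pcoeff (?p * f) c = (\<Sum>a \<in> {a. pcoeff ?p a \<noteq> 0 \<and> N \<le> a}. pcoeff ?p a * pcoeff f (c - a))"
      if "\<And>b. pcoeff f b \<noteq> 0 \<Longrightarrow> b \<le> M" "N \<le> c - M" for f M N
      unfolding times_puiseux.rep_eq using conv_eq_bound[OF left_finite_pcoeff, of "pcoeff f" M N c] that by blast
    obtain M1 where M1: "\<And>b. pcoeff g b \<noteq> 0 \<Longrightarrow> b \<le> M1"
      using left_finite_bounded[OF left_finite_pcoeff[of g]] by blast
    obtain M2 where M2: "\<And>b. pcoeff (s (K c)) b \<noteq> 0 \<Longrightarrow> b \<le> M2"
      using left_finite_bounded[OF left_finite_pcoeff[of "s (K c)"]] by blast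
    let ?F = "{a. pcoeff ?p a \<noteq> 0 \<and> c - max M1 M2 \<le> a}"
    have "pcoeff (?p * g) c = (\<Sum>a\<in>?F. pcoeff ?p a * pcoeff g (c - a))"
      by (rule cut[OF M1]) auto
    also have "\<dots> = (\<Sum>a\<in>?F. pcoeff ?p a * pcoeff (s (K c)) (c - a))"
    proof (rule sum.cong[OF refl])
      fix a assume "a \<in> ?F"
      then have "a \<le> 0" using p by blast
      then show "pcoeff ?p a * pcoeff g (c - a) = pcoeff ?p a * pcoeff (s (K c)) (c - a)"
        using h_eq[of c "c - a"] by (simp add: g)
    qed
    also have "\<dots> = pcoeff (?p * s (K c)) c"
      by (rule cut[OF M2, symmetric]) auto
    also have "?p * s (K c) = 1 - u ^ K c" unfolding s_def by (rule one_diff_power_eq[symmetric])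
    also have "pcoeff \<dots> c = pcoeff 1 c" using K[of c c "K c"] by simp
    finally show "pcoeff (?p * g) c = pcoeff 1 c" .
  qed
  then show ?thesis ..
qed

lift_definition pmonom :: "real \<Rightarrow> real \<Rightarrow> puiseux" is "\<lambda>x d b. if b = d then x else 0"
  by (rule left_finite_single)

lemma pcoeff_pmonom_mult: "pcoeff (pmonom x d * f) c = x * pcoeff f (c - d)"
  by (simp add: times_puiseux.rep_eq pmonom.rep_eq conv_single)

lemma puiseux_invertible:
  assumes "f \<noteq> 0" shows "\<exists>g :: puiseux. f * g = 1"
proof -
  define e where "e = lead_exp f"
  define x where "x = pcoeff f e"
  have x: "x \<noteq> 0" using lead_exp(1)[OF assms] by (simp add: x_def e_def)
  define m where "m = pmonom (1 / x) (- e)"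
  define u where "u = 1 - m * f"
  have cu: "pcoeff u b = (if b = 0 then 1 else 0) - pcoeff f (b + e) / x" for b
    by (simp add: u_def m_def pcoeff_pmonom_mult)
  have neg: "b < 0" if "pcoeff u b \<noteq> 0" for b
  proof -
    have "b \<noteq> 0" using that x by (auto simp: cu x_def)
    then have "pcoeff f (b + e) \<noteq> 0" using that by (auto simp: cu)
    then have "b + e \<le> e" unfolding e_def by (rule lead_exp(2)[OF assms])
    then show ?thesis using \<open>b \<noteq> 0\<close> by simp
  qed
  have "\<exists>d>0. \<forall>b. pcoeff u b \<noteq> 0 \<longrightarrow> b \<le> - d"
  proof (cases "u = 0")
    case True then show ?thesis by (intro exI[of _ 1]) auto
  next
    case False
    then show ?thesis using lead_exp[OF False] neg[of "lead_exp u"]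
      by (intro exI[of _ "- lead_exp u"]) auto
  qed
  then obtain g where "(1 - u) * g = 1" using one_minus_invertible[of u] by blast
  then have "f * (m * g) = 1" by (simp add: u_def algebra_simps)
  then show ?thesis ..
qed

instantiation puiseux :: field
begin

definition inverse_puiseux :: "puiseux \<Rightarrow> puiseux" where
  "inverse_puiseux f = (if f = 0 then 0 else (THE g. f * g = 1))"

definition divide_puiseux :: "puiseux \<Rightarrow> puiseux \<Rightarrow> puiseux" where
  "divide_puiseux f g = f * inverse g"

instance
proof
  fix f g :: puiseux
  show "inverse f * f = 1" if nz: "f \<noteq> 0"
  proof -
    obtain g where g: "f * g = 1" using puiseux_invertible[OF nz] by blast
    have "h = g" if "f * h = 1" for h
      using that g by (metis mult.assoc mult.commute mult.left_neutral)
    then have "(THE g. f * g = 1) = g" using g by blast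
    then show ?thesis using g nz by (simp add: inverse_puiseux_def mult.commute)
  qed
qed (simp_all add: inverse_puiseux_def divide_puiseux_def)

end

subsection \<open>Order\<close>

definition puiseux_pos :: "puiseux \<Rightarrow> bool" where
  "puiseux_pos f \<longleftrightarrow> f \<noteq> 0 \<and> pcoeff f (lead_exp f) > 0"

lemma puiseux_pos_iff:
  "puiseux_pos f \<longleftrightarrow> (\<exists>d. pcoeff f d > 0 \<and> (\<forall>b. pcoeff f b \<noteq> 0 \<longrightarrow> b \<le> d))"
proof
  assume "puiseux_pos f"
  then show "\<exists>d. pcoeff f d > 0 \<and> (\<forall>b. pcoeff f b \<noteq> 0 \<longrightarrow> b \<le> d)"
    using lead_exp[of f] by (auto simp: puiseux_pos_def)
next
  assume "\<exists>d. pcoeff f d > 0 \<and> (\<forall>b. pcoeff f b \<noteq> 0 \<longrightarrow> b \<le> d)"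
  then obtain d where d: "pcoeff f d > 0" "\<forall>b. pcoeff f b \<noteq> 0 \<longrightarrow> b \<le> d" by blast
  then have "lead_exp f = d" by (intro lead_exp_eqI) auto
  then show "puiseux_pos f" using d by (auto simp: puiseux_pos_def)
qed

lemma puiseux_pos_add: assumes "puiseux_pos f" "puiseux_pos g" shows "puiseux_pos (f + g)"
proof -
  obtain d where d: "pcoeff f d > 0" "\<And>b. pcoeff f b \<noteq> 0 \<Longrightarrow> b \<le> d"
    using assms(1) by (auto simp: puiseux_pos_iff)
  obtain e where e: "pcoeff g e > 0" "\<And>b. pcoeff g b \<noteq> 0 \<Longrightarrow> b \<le> e"
    using assms(2) by (auto simp: puiseux_pos_iff)
  have "pcoeff f (max d e) + pcoeff g (max d e) > 0"
  proof (cases d e rule: linorder_cases)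
    case less
    then have "pcoeff f e = 0" using d(2)[of e] by force
    then show ?thesis using less e(1) by simp
  next
    case greater
    then have "pcoeff g d = 0" using e(2)[of d] by force
    then show ?thesis using greater d(1) by simp
  qed (use d(1) e(1) in simp)
  moreover have "b \<le> max d e" if "pcoeff f b + pcoeff g b \<noteq> 0" for b
    using that d(2)[of b] e(2)[of b] by (cases "pcoeff f b = 0") auto
  ultimately show ?thesis unfolding puiseux_pos_iff by auto
qed

lemma puiseux_pos_mult: assumes "puiseux_pos f" "puiseux_pos g" shows "puiseux_pos (f * g)"
proof -
  obtain d where d: "pcoeff f d > 0" "\<And>b. pcoeff f b \<noteq> 0 \<Longrightarrow> b \<le> d"
    using assms(1) by (auto simp: puiseux_pos_iff)
  obtain e where e: "pcoeff g e > 0" "\<And>b. pcoeff g b \<noteq> 0 \<Longrightarrow> b \<le> e"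
    using assms(2) by (auto simp: puiseux_pos_iff)
  show ?thesis unfolding puiseux_pos_iff
    using pcoeff_mult_lead[of f d g e] d e by (intro exI[of _ "d + e"]) auto
qed

lemma puiseux_pos_cases: "f = 0 \<or> puiseux_pos f \<or> puiseux_pos (- f)"
proof (cases "f = 0")
  case False
  note l = lead_exp[OF False]
  show ?thesis
  proof (cases "pcoeff f (lead_exp f) > 0")
    case True
    then show ?thesis using l unfolding puiseux_pos_iff by blast
  next
    case neg: False
    then have "puiseux_pos (- f)"
      using l unfolding puiseux_pos_iff by (intro exI[of _ "lead_exp f"]) auto
    then show ?thesis by simp
  qed
qed simp

lemma puiseux_pos_not_zero: "\<not> puiseux_pos 0"
  by (simp add: puiseux_pos_def)

instantiation puiseux :: linordered_field
begin

definition less_puiseux :: "puiseux \<Rightarrow> puiseux \<Rightarrow> bool" where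
  "f < g \<longleftrightarrow> puiseux_pos (g - f)"

definition less_eq_puiseux :: "puiseux \<Rightarrow> puiseux \<Rightarrow> bool" where
  "f \<le> g \<longleftrightarrow> f = g \<or> puiseux_pos (g - f)"

definition abs_puiseux :: "puiseux \<Rightarrow> puiseux" where
  "abs_puiseux f = (if f < 0 then - f else f)"

definition sgn_puiseux :: "puiseux \<Rightarrow> puiseux" where
  "sgn_puiseux f = (if f = 0 then 0 else if 0 < f then 1 else - 1)"

instance
proof
  fix f g h :: puiseux
  have asym: False if "puiseux_pos (f - g)" "puiseux_pos (g - f)" for f g
    using puiseux_pos_add[OF that] puiseux_pos_not_zero by simp
  have trans: "puiseux_pos (h - f)" if "puiseux_pos (g - f)" "puiseux_pos (h - g)" for f g h
    using puiseux_pos_add[OF that] by simp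
  show "f < g \<longleftrightarrow> f \<le> g \<and> \<not> g \<le> f"
    unfolding less_puiseux_def less_eq_puiseux_def
    using asym[of g f] puiseux_pos_not_zero by (metis diff_self)
  show "f \<le> f" by (simp add: less_eq_puiseux_def)
  show "f \<le> h" if "f \<le> g" "g \<le> h"
    using that trans[of g f h] unfolding less_eq_puiseux_def by metis
  show "f = g" if "f \<le> g" "g \<le> f"
    using that asym[of g f] unfolding less_eq_puiseux_def by metis
  show "f \<le> g \<or> g \<le> f"
    using puiseux_pos_cases[of "g - f"] unfolding less_eq_puiseux_def
    by (metis minus_diff_eq right_minus_eq)
  show "h + f \<le> h + g" if "f \<le> g"
    using that unfolding less_eq_puiseux_def by (metis add_diff_cancel_left)
  show "h * f < h * g" if "f < g" "0 < h"
    using puiseux_pos_mult[of h "g - f"] that unfolding less_puiseux_def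
    by (metis diff_zero right_diff_distrib)
  show "\<bar>f\<bar> = (if f < 0 then - f else f)" by (rule abs_puiseux_def)
  show "sgn f = (if f = 0 then 0 else if 0 < f then 1 else - 1)" by (rule sgn_puiseux_def)
qed

end

section \<open>Total positivity\<close>

text \<open>\<open>submatrix\<close> keeps the selected rows and columns in their natural order.\<close>

definition TP :: "'a :: linordered_field mat \<Rightarrow> bool" where
  "TP A \<longleftrightarrow> (\<forall>I J. I \<subseteq> {0..<dim_row A} \<longrightarrow> J \<subseteq> {0..<dim_col A} \<longrightarrow> card I = card J \<longrightarrow>
     det (submatrix A I J) > 0)"

section \<open>Tropical matrices\<close>

text \<open>
  The max-plus semiring is the part of \<^typ>\<open>ereal\<close> without \<open>\<infinity>\<close>: tropical addition is \<^term>\<open>max\<close>,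
  tropical multiplication is \<open>+\<close>, and the \<open>i\<close>-th tropical power of \<open>x\<close> is \<open>ereal (real i) * x\<close>
  (which is \<open>0\<close> for \<open>i = 0\<close>, also at \<open>x = -\<infinity>\<close>).
\<close>

definition trop_weight :: "ereal mat \<Rightarrow> (nat \<Rightarrow> nat) \<Rightarrow> ereal" where
  "trop_weight M \<sigma> = (\<Sum>i = 0..<dim_row M. M $$ (i, \<sigma> i))"

definition trop_per :: "ereal mat \<Rightarrow> ereal" where
  "trop_per M = Max (trop_weight M ` {\<sigma>. \<sigma> permutes {0..<dim_row M}})"

definition trop_TP :: "ereal mat \<Rightarrow> bool" where
  "trop_TP A \<longleftrightarrow>
     (\<forall>i<dim_row A. \<forall>j<dim_col A. \<bar>A $$ (i, j)\<bar> \<noteq> \<infinity>) \<and>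
     (\<forall>I J. I \<subseteq> {0..<dim_row A} \<longrightarrow> J \<subseteq> {0..<dim_col A} \<longrightarrow> card I = card J \<longrightarrow>
       (\<forall>\<sigma>. \<sigma> permutes {0..<card I} \<longrightarrow>
          trop_weight (submatrix A I J) \<sigma> = trop_per (submatrix A I J) \<longrightarrow> evenperm \<sigma>))"

definition trop_one :: "nat \<Rightarrow> ereal mat" where
  "trop_one n = mat n n (\<lambda>(i, j). if i = j then 0 else -\<infinity>)"

definition trop_char_poly :: "ereal mat \<Rightarrow> ereal \<Rightarrow> ereal" where
  "trop_char_poly A x =
     trop_per (mat (dim_row A) (dim_row A)
       (\<lambda>(i, j). max (x + trop_one (dim_row A) $$ (i, j)) (A $$ (i, j))))"

text \<open>\<open>trop_coeff A 0 = 0\<close>, since the only permutation of the empty matrix has weight \<open>0\<close>.\<close>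

definition trop_coeff :: "ereal mat \<Rightarrow> nat \<Rightarrow> ereal" where
  "trop_coeff A k = Max ((\<lambda>I. trop_per (submatrix A I I)) ` {I. I \<subseteq> {0..<dim_row A} \<and> card I = k})"

definition trop_term :: "ereal mat \<Rightarrow> nat \<Rightarrow> ereal \<Rightarrow> ereal" where
  "trop_term A i x = trop_coeff A (dim_row A - i) + ereal (real i) * x"

lemma trop_coeff_0: "trop_coeff A 0 = 0"
proof -
  have "{I. I \<subseteq> {0..<dim_row A} \<and> card I = 0} = {{}}"
    by (auto dest: finite_subset)
  then show ?thesis
    by (simp add: trop_coeff_def trop_per_def trop_weight_def dim_submatrix)
qed

text \<open>
  The tropical characteristic polynomial is the maximum of the terms
  \<open>trop_coeff A (n - i) + i * x\<close> for \<open>0 \<le> i \<le> n\<close>.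
\<close>

lemma bij_betw_pick:
  assumes "finite I"
  shows "bij_betw (pick I) {0..<card I} I"
proof -
  have inj: "inj_on (pick I) {0..<card I}"
    by (rule inj_onI) (metis atLeastLessThan_iff card_pick_le)
  moreover have "pick I ` {0..<card I} \<subseteq> I" by (auto simp: pick_in_set_le)
  moreover have "card (pick I ` {0..<card I}) = card I" using card_image[OF inj] by simp
  ultimately show ?thesis unfolding bij_betw_def using card_subset_eq[OF assms] by blast
qed

lemma trop_per_principal:
  assumes "A \<in> carrier_mat n n" "I \<subseteq> {0..<n}"
  shows "trop_per (submatrix A I I) = Max ((\<lambda>\<sigma>. \<Sum>i\<in>I. A $$ (i, \<sigma> i)) ` {\<sigma>. \<sigma> permutes I})"
proof -
  have finI: "finite I" using assms(2) by (rule finite_subset) simp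
  let ?K = "{0..<card I}"
  have eqI: "{i. i < n \<and> i \<in> I} = I" using assms(2) by auto
  have bij: "bij_betw (pick I) ?K I" by (rule bij_betw_pick[OF finI])
  have dims: "dim_row (submatrix A I I) = card I" using assms(1) by (simp add: dim_submatrix eqI)
  have w: "trop_weight (submatrix A I I) \<tau> = (\<Sum>i\<in>I. A $$ (i, map_permutation ?K (pick I) \<tau> i))"
    if t: "\<tau> permutes ?K" for \<tau>
  proof -
    have "trop_weight (submatrix A I I) \<tau> = (\<Sum>i\<in>?K. A $$ (pick I i, pick I (\<tau> i)))"
      unfolding trop_weight_def dims
    proof (rule sum.cong[OF refl])
      fix i assume i: "i \<in> ?K"
      then have "\<tau> i \<in> ?K" using t permutes_in_image by metis
      then show "submatrix A I I $$ (i, \<tau> i) = A $$ (pick I i, pick I (\<tau> i))"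
        using i assms(1) by (intro submatrix_index) (auto simp: eqI)
    qed
    also have "\<dots> = (\<Sum>i\<in>?K. A $$ (pick I i, map_permutation ?K (pick I) \<tau> (pick I i)))"
      using bij by (intro sum.cong) (auto simp: map_permutation_apply bij_betw_def)
    also have "\<dots> = (\<Sum>i\<in>I. A $$ (i, map_permutation ?K (pick I) \<tau> i))"
      by (rule sum.reindex_bij_betw[OF bij])
    finally show ?thesis .
  qed
  have surj: "\<exists>\<tau>. \<tau> permutes ?K \<and> map_permutation ?K (pick I) \<tau> = \<sigma>" if s: "\<sigma> permutes I" for \<sigma>
  proof -
    have bij': "bij_betw (inv_into ?K (pick I)) I ?K" by (rule bij_betw_inv_into[OF bij])
    show ?thesis
      by (rule exI[of _ "map_permutation I (inv_into ?K (pick I)) \<sigma>"], rule conjI,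
          rule map_permutation_permutes[OF bij' s],
          rule map_permutation_compose_inv[OF bij' s bij_betw_inv_into_right[OF bij]])
  qed
  have "trop_weight (submatrix A I I) ` {\<sigma>. \<sigma> permutes ?K} =
      (\<lambda>\<sigma>. \<Sum>i\<in>I. A $$ (i, \<sigma> i)) ` {\<sigma>. \<sigma> permutes I}" (is "?L = ?R")
  proof
    show "?L \<subseteq> ?R" using w map_permutation_permutes[OF bij] by blast
    show "?R \<subseteq> ?L"
    proof
      fix y assume "y \<in> ?R"
      then obtain \<sigma> where s: "\<sigma> permutes I" "y = (\<Sum>i\<in>I. A $$ (i, \<sigma> i))" by blast
      obtain \<tau> where "\<tau> permutes ?K" "map_permutation ?K (pick I) \<tau> = \<sigma>" using surj[OF s(1)] by blast
      then show "y \<in> ?L" using w[of \<tau>] s(2) by (intro image_eqI[of _ _ \<tau>]) auto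
    qed
  qed
  then show ?thesis by (simp add: trop_per_def dims)
qed

lemma trop_char_poly_eq_Max:
  assumes A: "A \<in> carrier_mat n n" and x: "x \<noteq> \<infinity>"
  shows "trop_char_poly A x = Max ((\<lambda>i. trop_term A i x) ` {0..n})"
proof -
  define M where "M = mat n n (\<lambda>(i, j). max (x + trop_one n $$ (i, j)) (A $$ (i, j)))"
  have M: "M \<in> carrier_mat n n" and f: "trop_char_poly A x = trop_per M"
    using A by (auto simp: M_def trop_char_poly_def)
  have sum_const: "(\<Sum>i\<in>Z. x) = ereal (real (card Z)) * x" if "finite Z" for Z :: "nat set"
    using that
  proof (induction Z)
    case (insert a Z)
    have "x + ereal (real (card Z)) * x = (1 + ereal (real (card Z))) * x"
      by (subst ereal_left_distrib) auto
    then show ?case using insert by (simp add: one_ereal_def add.commute)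
  qed (simp add: zero_ereal_def[symmetric])
  have per_fin: "finite ((\<lambda>\<sigma>. \<Sum>i\<in>I. A $$ (i, \<sigma> i)) ` {\<sigma>. \<sigma> permutes I})" if "I \<subseteq> {0..<n}" for I
    using that by (intro finite_imageI finite_permutations) (auto intro: finite_subset)
  have Ifin: "finite {I. I \<subseteq> {0..<n} \<and> card I = k}" for k
    by (rule finite_subset[of _ "Pow {0..<n}"]) auto
  have wfin: "finite (trop_weight M ` {\<sigma>. \<sigma> permutes {0..<n}})"
    by (intro finite_imageI finite_permutations) simp
  have perM: "trop_per M = Max (trop_weight M ` {\<sigma>. \<sigma> permutes {0..<n}})"
    using M by (simp add: trop_per_def)
  have Mii: "M $$ (i, i) = max x (A $$ (i, i))" if "i < n" for i
    using that by (simp add: M_def trop_one_def)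
  have Mij: "M $$ (i, j) = A $$ (i, j)" if "i < n" "j < n" "i \<noteq> j" for i j
    using that x by (cases x) (simp_all add: M_def trop_one_def max_def)
  have MA: "A $$ (i, j) \<le> M $$ (i, j)" if "i < n" "j < n" for i j
    using that by (simp add: M_def)
  have upper: "trop_term A k x \<le> trop_per M" if k: "k \<le> n" for k
  proof -
    have ne: "{I. I \<subseteq> {0..<n} \<and> card I = n - k} \<noteq> {}"
      using obtain_subset_with_card_n[of "n - k" "{0..<n}"] by auto
    have "trop_coeff A (n - k) \<in> (\<lambda>I. trop_per (submatrix A I I)) ` {I. I \<subseteq> {0..<n} \<and> card I = n - k}"
      unfolding trop_coeff_def carrier_matD(1)[OF A]
      by (intro Max_in finite_imageI Ifin) (simp only: image_is_empty ne not_False_eq_True)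
    then obtain I where I: "I \<subseteq> {0..<n}" "card I = n - k"
      and tI: "trop_coeff A (n - k) = trop_per (submatrix A I I)" by blast
    have finI: "finite I" using I(1) by (rule finite_subset) simp
    have "{\<sigma>. \<sigma> permutes I} \<noteq> {}" using permutes_id by blast
    then have "trop_per (submatrix A I I) \<in> (\<lambda>\<sigma>. \<Sum>i\<in>I. A $$ (i, \<sigma> i)) ` {\<sigma>. \<sigma> permutes I}"
      unfolding trop_per_principal[OF A I(1)] by (intro Max_in[OF per_fin[OF I(1)]]) (simp only: image_is_empty not_False_eq_True)
    then obtain \<sigma> where s: "\<sigma> permutes I" and tp: "trop_per (submatrix A I I) = (\<Sum>i\<in>I. A $$ (i, \<sigma> i))"
      by blast
    have s': "\<sigma> permutes {0..<n}" using s I(1) by (rule permutes_subset)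
    let ?Z = "{0..<n} - I"
    have cZ: "card ?Z = k" using I k finI by (simp add: card_Diff_subset)
    have "trop_term A k x = (\<Sum>i\<in>I. A $$ (i, \<sigma> i)) + (\<Sum>i\<in>?Z. x)"
      using A k by (simp add: trop_term_def tI tp sum_const cZ)
    also have "\<dots> \<le> (\<Sum>i\<in>I. M $$ (i, \<sigma> i)) + (\<Sum>i\<in>?Z. M $$ (i, \<sigma> i))"
    proof (intro add_mono sum_mono)
      fix i assume i: "i \<in> I"
      then have "\<sigma> i \<in> I" using s permutes_in_image by metis
      then show "A $$ (i, \<sigma> i) \<le> M $$ (i, \<sigma> i)" using i I(1) by (intro MA) auto
    next
      fix i assume i: "i \<in> ?Z"
      then have "\<sigma> i = i" using s by (auto simp: permutes_def)
      then show "x \<le> M $$ (i, \<sigma> i)" using i Mii[of i] by simp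
    qed
    also have "\<dots> = trop_weight M \<sigma>"
      using M I(1) by (simp add: trop_weight_def sum.subset_diff[of I "{0..<n}"] add.commute)
    also have "\<dots> \<le> trop_per M" unfolding perM using wfin s' by (intro Max_ge) auto
    finally show ?thesis .
  qed
  have lower: "\<exists>k\<le>n. trop_per M \<le> trop_term A k x"
  proof -
    have "{\<sigma>. \<sigma> permutes {0..<n}} \<noteq> {}" using permutes_id by blast
    then have "trop_per M \<in> trop_weight M ` {\<sigma>. \<sigma> permutes {0..<n}}"
      unfolding perM by (intro Max_in[OF wfin]) (simp only: image_is_empty not_False_eq_True)
    then obtain \<sigma> where s: "\<sigma> permutes {0..<n}" and tp: "trop_per M = trop_weight M \<sigma>" by blast
    define Z where "Z = {i \<in> {0..<n}. \<sigma> i = i \<and> A $$ (i, i) \<le> x}"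
    let ?I = "{0..<n} - Z"
    have Zn: "Z \<subseteq> {0..<n}" by (auto simp: Z_def)
    have finZ: "finite Z" using Zn by (rule finite_subset) simp
    have cZ: "card Z \<le> n" using card_mono[OF _ Zn] by simp
    have cI: "card ?I = n - card Z" using card_Diff_subset[OF finZ Zn] by simp
    have sI: "\<sigma> permutes ?I"
      by (rule permutes_superset[OF s]) (auto simp: Z_def)
    have "trop_weight M \<sigma> = (\<Sum>i\<in>?I. M $$ (i, \<sigma> i)) + (\<Sum>i\<in>Z. M $$ (i, \<sigma> i))"
      using M by (simp add: trop_weight_def sum.subset_diff[OF Zn])
    also have "(\<Sum>i\<in>Z. M $$ (i, \<sigma> i)) = (\<Sum>i\<in>Z. x)"
      by (rule sum.cong) (auto simp: Z_def Mii max_def)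
    also have "(\<Sum>i\<in>?I. M $$ (i, \<sigma> i)) = (\<Sum>i\<in>?I. A $$ (i, \<sigma> i))"
    proof (rule sum.cong[OF refl])
      fix i assume i: "i \<in> ?I"
      have si: "\<sigma> i < n" using i s permutes_in_image[OF s, of i] by simp
      show "M $$ (i, \<sigma> i) = A $$ (i, \<sigma> i)"
        using i si Mij[of i "\<sigma> i"] by (cases "\<sigma> i = i") (auto simp: Z_def Mii max_def)
    qed
    also have "(\<Sum>i\<in>?I. A $$ (i, \<sigma> i)) \<le> trop_per (submatrix A ?I ?I)"
      unfolding trop_per_principal[OF A Diff_subset]
      by (rule Max_ge[OF per_fin[OF Diff_subset]]) (use sI in auto)
    also have "trop_per (submatrix A ?I ?I) \<le> trop_coeff A (n - card Z)"
      unfolding trop_coeff_def using A Ifin cI by (intro Max_ge) auto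
    also have "(\<Sum>i\<in>Z. x) = ereal (real (card Z)) * x" by (rule sum_const[OF finZ])
    finally have "trop_weight M \<sigma> \<le> trop_term A (card Z) x"
      using A cZ by (simp add: trop_term_def add_right_mono)
    then show ?thesis using cZ tp by auto
  qed
  obtain k where k: "k \<le> n" "trop_per M \<le> trop_term A k x" using lower by blast
  show ?thesis unfolding f
    by (rule sym, rule Max_eqI) (use upper k antisym[OF k(2) upper[OF k(1)]] in auto)
qed

definition trop_eigenvalue :: "ereal mat \<Rightarrow> ereal \<Rightarrow> bool" where
  "trop_eigenvalue A \<eta> \<longleftrightarrow> \<eta> \<noteq> \<infinity> \<and>
     (\<exists>i j. i \<le> dim_row A \<and> j \<le> dim_row A \<and> i \<noteq> j \<and>
        trop_term A i \<eta> = trop_char_poly A \<eta> \<and> trop_term A j \<eta> = trop_char_poly A \<eta>)"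

definition the_deriv :: "(real \<Rightarrow> real) \<Rightarrow> real filter \<Rightarrow> real" where
  "the_deriv f F = (THE D. (f has_real_derivative D) F)"

text \<open>
  At real arguments the tropical characteristic polynomial of a matrix without entries \<open>\<infinity>\<close> is
  real-valued, because of the term \<open>n * x\<close>.
\<close>

definition trop_multiplicity :: "ereal mat \<Rightarrow> ereal \<Rightarrow> real" where
  "trop_multiplicity A \<eta> =
     (let f = (\<lambda>t. real_of_ereal (trop_char_poly A (ereal t))) in
      if \<eta> = -\<infinity> then Lim at_bot (\<lambda>t. the_deriv f (at t))
      else the_deriv f (at_right (real_of_ereal \<eta>)) - the_deriv f (at_left (real_of_ereal \<eta>)))"

definition trop_eigenvalue_list :: "ereal mat \<Rightarrow> (nat \<Rightarrow> ereal) \<Rightarrow> bool" where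
  "trop_eigenvalue_list A \<eta> \<longleftrightarrow>
     (\<forall>i j. 1 \<le> i \<longrightarrow> i \<le> j \<longrightarrow> j \<le> dim_row A \<longrightarrow> \<eta> j \<le> \<eta> i) \<and>
     (\<forall>i \<in> {1..dim_row A}. trop_eigenvalue A (\<eta> i)) \<and>
     (\<forall>x. trop_eigenvalue A x \<longrightarrow>
        real (card {i \<in> {1..dim_row A}. \<eta> i = x}) = trop_multiplicity A x)"

end

theory Submission
  imports Defs
begin

text \<open>
  Positivity excludes cancellation, so that valuations can be read off term by term.

  Up to sign, the coefficient \<open>\<alpha> k\<close> of the characteristic polynomial is the sum of the principal
  minors of order \<open>k\<close> (lemma \<open>char_poly_principal_minors\<close>).  Total positivity of \<open>A\<close> makes these
  minors positive, and the valuation of a sum of nonnegative series is the maximum of their valuations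
  (\<open>val_sum_nonneg\<close>).  Each minor has the tropical permanent as its valuation: in the Leibniz formula
  the terms of maximum weight all carry the sign \<open>+\<close>, because the valuations of the entries form a
  tropically totally positive matrix, and so their leading terms add up (\<open>val_det_eq_trop_per\<close>).
  Hence \<open>val (\<alpha> k)\<close> is the \<open>k\<close>-th coefficient of the tropical characteristic polynomial.

  The eigenvalues \<open>\<rho> i\<close> are positive (\<open>TP_eigenvalue_pos\<close>), and as there are \<open>n\<close> of them they exhaust
  the roots of the characteristic polynomial.  By Vieta, \<open>\<alpha> k\<close> is also the \<open>k\<close>-th elementary symmetric
  polynomial in the \<open>\<rho> i\<close>.  Its monomials are positive as well, and the largest valuation among them
  belongs to \<open>\<rho> 1 * \<dots> * \<rho> k\<close> (\<open>val_elem_sym\<close>).  With \<open>v i = val (\<rho> i)\<close> the tropical coefficients are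
  therefore the partial sums \<open>v 1 + \<dots> + v k\<close> of a decreasing real sequence.  A tropical polynomial
  with such coefficients is the function \<open>\<Sum>i. max x (v i)\<close>, whose slope at \<open>x\<close> jumps by the number
  of indices \<open>i\<close> with \<open>v i = x\<close>.  So the \<open>v i\<close> are the tropical eigenvalues with their multiplicities,
  and two decreasing lists with the same multiplicities agree (\<open>eigenvalue_list_unique\<close>).
\<close>

section \<open>Valuations of sums and products\<close>

lemma val_mult: "val (f * g) = val f + val g"
proof (cases "f = 0 \<or> g = 0")
  case True
  then show ?thesis by (auto simp: val_def)
next
  case False
  then have f: "f \<noteq> 0" and g: "g \<noteq> 0" by auto
  note l = pcoeff_mult_lead[of f "lead_exp f" g "lead_exp g", OF lead_exp(2)[OF f] lead_exp(2)[OF g]]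
  have "lead_exp (f * g) = lead_exp f + lead_exp g"
    by (rule lead_exp_eqI) (use l lead_exp(1)[OF f] lead_exp(1)[OF g] in auto)
  then show ?thesis using f g by (simp add: val_def)
qed

lemma val_1: "val 1 = 0"
proof -
  have "lead_exp 1 = 0" by (rule lead_exp_eqI) (auto split: if_splits)
  then show ?thesis by (simp add: val_def zero_ereal_def)
qed

lemma val_prod: "val (\<Prod>x\<in>X. f x) = (\<Sum>x\<in>X. val (f x))"
  by (induction X rule: infinite_finite_induct) (simp_all add: val_1 val_mult)

text \<open>
  Bounds on valuations are bounds on the support, which avoids a case distinction on zero series
  when sums are estimated.
\<close>

lemma val_le_iff: "val f \<le> ereal d \<longleftrightarrow> (\<forall>b. pcoeff f b \<noteq> 0 \<longrightarrow> b \<le> d)"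
proof (cases "f = 0")
  case True
  then show ?thesis by (simp add: val_def)
next
  case False
  then show ?thesis using lead_exp[OF False] by (fastforce simp: val_def)
qed

lemma val_add_le: "val (f + g) \<le> max (val f) (val g)"
proof -
  have "val f \<noteq> \<infinity>" "val g \<noteq> \<infinity>" by (auto simp: val_def)
  show ?thesis
  proof (cases "max (val f) (val g)")
    case (real d)
    then have *: "val f \<le> ereal d" "val g \<le> ereal d"
      by (metis max.cobounded1, metis max.cobounded2)
    show ?thesis unfolding real val_le_iff
    proof (intro allI impI)
      fix b assume "pcoeff (f + g) b \<noteq> 0"
      then have "pcoeff f b \<noteq> 0 \<or> pcoeff g b \<noteq> 0" by auto
      then show "b \<le> d" using * unfolding val_le_iff by blast
    qed
  next
    case MInf
    then have "f = 0" "g = 0" by (auto simp: val_def max_def split: if_splits)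
    then show ?thesis by (simp add: val_def)
  qed (use \<open>val f \<noteq> \<infinity>\<close> \<open>val g \<noteq> \<infinity>\<close> in \<open>auto simp: max_def split: if_splits\<close>)
qed

lemma val_uminus: "val (- f) = val f"
proof (cases "f = 0")
  case False
  have "lead_exp (- f) = lead_exp f"
    by (rule lead_exp_eqI) (use lead_exp[OF False] in auto)
  then show ?thesis using False by (simp add: val_def)
qed simp

text \<open>
  The ultrametric inequality, applied once to \<open>f - g\<close> and once to \<open>f = (f - g) + g\<close>.
\<close>

lemma val_diff_dominant:
  assumes "val g < val f"
  shows "val (f - g) = val f"
proof (rule antisym)
  show "val (f - g) \<le> val f"
    using val_add_le[of f "- g"] assms by (simp add: val_uminus)
  have "val f \<le> max (val (f - g)) (val g)"
    using val_add_le[of "f - g" g] by simp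
  then show "val f \<le> val (f - g)" using assms by (auto simp: max_def split: if_splits)
qed

text \<open>
  If \<open>val g < val f\<close>, then \<open>f - g\<close> has the leading term of \<open>f\<close> and is therefore positive.  This
  compatibility of valuation and order is what rules out cancellation between nonnegative series.
\<close>

lemma val_mono:
  assumes "0 \<le> f" "f \<le> g"
  shows "val f \<le> val g"
proof (rule ccontr)
  assume "\<not> val f \<le> val g"
  then have less: "val g < val f" by simp
  then have f0: "f \<noteq> 0" by (auto simp: val_def)
  then have "puiseux_pos f" using assms(1) by (simp add: less_eq_puiseux_def)
  then have pos: "pcoeff f (lead_exp f) > 0" by (simp add: puiseux_pos_def)
  have vf: "val (f - g) = ereal (lead_exp f)"
    using val_diff_dominant[OF less] f0 by (simp add: val_def)
  have "pcoeff g (lead_exp f) = 0"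
  proof (cases "g = 0")
    case False
    then show ?thesis
      using lead_exp(2)[OF False, of "lead_exp f"] less f0 by (force simp: val_def)
  qed simp
  then have "puiseux_pos (f - g)"
    unfolding puiseux_pos_iff using pos vf val_le_iff[of "f - g" "lead_exp f"]
    by (intro exI[of _ "lead_exp f"]) auto
  then have "g < f" by (simp add: less_puiseux_def)
  then show False using assms(2) by simp
qed

lemma val_sum_le:
  assumes "\<And>x. x \<in> X \<Longrightarrow> val (f x) \<le> d"
  shows "val (\<Sum>x\<in>X. f x) \<le> d"
  using assms
proof (induction X rule: infinite_finite_induct)
  case (insert x X)
  have "val (f x + (\<Sum>x\<in>X. f x)) \<le> max (val (f x)) (val (\<Sum>x\<in>X. f x))" by (rule val_add_le)
  also have "\<dots> \<le> d" using insert by auto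
  finally show ?case using insert by simp
qed (simp_all add: val_def)

text \<open>
  Each summand lies below the sum, so monotonicity of the valuation gives the inequality that the
  ultrametric inequality leaves open.
\<close>

lemma val_sum_nonneg:
  assumes "finite X" "X \<noteq> {}" "\<And>x. x \<in> X \<Longrightarrow> 0 \<le> f x"
  shows "val (\<Sum>x\<in>X. f x) = Max ((\<lambda>x. val (f x)) ` X)"
proof (rule antisym)
  show "val (\<Sum>x\<in>X. f x) \<le> Max ((\<lambda>x. val (f x)) ` X)"
    using assms(1) by (intro val_sum_le Max_ge) auto
  show "Max ((\<lambda>x. val (f x)) ` X) \<le> val (\<Sum>x\<in>X. f x)"
  proof (rule Max.boundedI)
    fix y assume "y \<in> (\<lambda>x. val (f x)) ` X"
    then obtain x where x: "x \<in> X" "y = val (f x)" by auto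
    show "y \<le> val (\<Sum>x\<in>X. f x)"
      unfolding x(2) by (intro val_mono member_le_sum) (use x assms in auto)
  qed (use assms in auto)
qed

section \<open>Valuations of determinants\<close>

text \<open>
  The determinant is the difference \<open>P - N\<close> of the positive sums of the even and of the odd terms of
  the Leibniz formula.  The valuation of a term is the weight of its permutation.  Since the maximum
  weight is attained, and by even permutations only, \<open>P\<close> has the maximum weight as its valuation and
  dominates \<open>N\<close>.
\<close>

lemma val_det_eq_trop_per:
  assumes M: "M \<in> carrier_mat m m"
    and pos: "\<And>i j. i < m \<Longrightarrow> j < m \<Longrightarrow> 0 < M $$ (i, j)"
    and even: "\<And>\<sigma>. \<sigma> permutes {0..<m} \<Longrightarrow>
      trop_weight (map_mat val M) \<sigma> = trop_per (map_mat val M) \<Longrightarrow> evenperm \<sigma>"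
  shows "val (det M) = trop_per (map_mat val M)"
proof -
  let ?S = "{\<sigma>. \<sigma> permutes {0..<m}}"
  let ?w = "trop_weight (map_mat val M)"
  define t where "t \<sigma> = (\<Prod>i = 0..<m. M $$ (i, \<sigma> i))" for \<sigma>
  have finS: "finite ?S" by (simp add: finite_permutations)
  have t_pos: "0 < t \<sigma>" if "\<sigma> \<in> ?S" for \<sigma>
    unfolding t_def
  proof (rule prod_pos)
    fix i assume "i \<in> {0..<m}"
    then show "0 < M $$ (i, \<sigma> i)" using permutes_in_image[of \<sigma> "{0..<m}" i] that by (intro pos) auto
  qed
  have val_t: "val (t \<sigma>) = ?w \<sigma>" if "\<sigma> \<in> ?S" for \<sigma>
    unfolding t_def val_prod trop_weight_def
  proof (rule sum.cong)
    fix i assume "i \<in> {0..<dim_row (map_mat val M)}"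
    then show "val (M $$ (i, \<sigma> i)) = map_mat val M $$ (i, \<sigma> i)"
      using permutes_in_image[of \<sigma> "{0..<m}" i] that M by simp
  qed (use M in simp)
  have per: "trop_per (map_mat val M) = Max (?w ` ?S)"
    using M by (simp add: trop_per_def)
  have "trop_per (map_mat val M) \<in> ?w ` ?S"
    unfolding per using finS permutes_id[of "{0..<m}"] by (intro Max_in) blast+
  then obtain \<sigma>0 where s0: "\<sigma>0 \<in> ?S" "?w \<sigma>0 = trop_per (map_mat val M)" by auto
  have le_per: "?w \<sigma> \<le> trop_per (map_mat val M)" if "\<sigma> \<in> ?S" for \<sigma>
    unfolding per using finS that by (intro Max_ge) auto
  define P where "P = (\<Sum>\<sigma> | \<sigma> \<in> ?S \<and> evenperm \<sigma>. t \<sigma>)"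
  define N where "N = (\<Sum>\<sigma> | \<sigma> \<in> ?S \<and> \<not> evenperm \<sigma>. t \<sigma>)"
  have "det M = (\<Sum>\<sigma>\<in>?S. signof \<sigma> * t \<sigma>)"
    using M by (simp add: det_def t_def)
  also have "\<dots> = (\<Sum>\<sigma>\<in>?S. if evenperm \<sigma> then t \<sigma> else - t \<sigma>)"
    by (rule sum.cong) (auto simp: sign_def)
  also have "\<dots> = P + (\<Sum>\<sigma> | \<sigma> \<in> ?S \<and> \<not> evenperm \<sigma>. - t \<sigma>)"
    using finS by (simp add: sum.If_cases P_def Collect_conj_eq Collect_neg_eq)
  finally have det: "det M = P - N" by (simp add: N_def sum_negf)
  have valP: "val P = trop_per (map_mat val M)"
  proof (rule antisym)
    show "val P \<le> trop_per (map_mat val M)"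
      unfolding P_def by (rule val_sum_le) (use val_t le_per in auto)
    have "evenperm \<sigma>0" using even s0 by blast
    then have "t \<sigma>0 \<le> P"
      unfolding P_def using s0(1) finS by (intro member_le_sum) (auto intro: less_imp_le t_pos)
    then have "val (t \<sigma>0) \<le> val P" using t_pos[OF s0(1)] by (intro val_mono) auto
    then show "trop_per (map_mat val M) \<le> val P" using val_t s0 by simp
  qed
  have "val (t \<sigma>0) \<noteq> -\<infinity>" using t_pos[OF s0(1)] by (auto simp: val_def)
  then have per_fin: "trop_per (map_mat val M) \<noteq> -\<infinity>" using val_t s0 by simp
  have "val N < trop_per (map_mat val M)"
  proof (cases "{\<sigma>. \<sigma> \<in> ?S \<and> \<not> evenperm \<sigma>} = {}")
    case True
    then have "N = 0" unfolding N_def by (simp only: sum.empty)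
    then show ?thesis using per_fin by (simp add: val_def less_ereal.simps ereal_MInfty_lessI)
  next
    case False
    have "val N = Max ((\<lambda>\<sigma>. val (t \<sigma>)) ` {\<sigma>. \<sigma> \<in> ?S \<and> \<not> evenperm \<sigma>})"
      unfolding N_def by (rule val_sum_nonneg) (use finS False in \<open>auto intro: less_imp_le t_pos\<close>)
    also have "\<dots> < trop_per (map_mat val M)"
    proof (subst Max_less_iff)
      show "\<forall>y\<in>(\<lambda>\<sigma>. val (t \<sigma>)) ` {\<sigma>. \<sigma> \<in> ?S \<and> \<not> evenperm \<sigma>}. y < trop_per (map_mat val M)"
        using val_t le_per even by (fastforce simp: order_less_le)
    qed (use finS False in auto)
    finally show ?thesis .
  qed
  then show ?thesis using valP val_diff_dominant[of N P] det by simp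
qed

section \<open>Coefficients of characteristic polynomials\<close>

text \<open>
  Transporting permutations along the increasing enumeration \<open>pick I\<close> preserves their sign.  With
  permutations of \<open>I\<close> itself, as here, minors for different \<open>I\<close> can be compared with permutations of
  the full index set.
\<close>

lemma det_principal_submatrix:
  fixes A :: "'a :: comm_ring_1 mat"
  assumes A: "A \<in> carrier_mat n n" and I: "I \<subseteq> {0..<n}"
  shows "det (submatrix A I I) = (\<Sum>\<sigma> | \<sigma> permutes I. signof \<sigma> * (\<Prod>i\<in>I. A $$ (i, \<sigma> i)))"
proof -
  have finI: "finite I" using I by (rule finite_subset) simp
  let ?K = "{0..<card I}"
  have eqI: "{i. i < n \<and> i \<in> I} = I" using I by auto
  have bij: "bij_betw (pick I) ?K I" by (rule bij_betw_pick[OF finI])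
  have bij': "bij_betw (inv_into ?K (pick I)) I ?K" by (rule bij_betw_inv_into[OF bij])
  have inj: "inj_on (pick I) ?K" using bij by (rule bij_betw_imp_inj_on)
  have sub: "submatrix A I I \<in> carrier_mat (card I) (card I)"
    using A by (intro carrier_matI) (simp_all add: dim_submatrix eqI)
  have "det (submatrix A I I) =
      (\<Sum>\<tau> | \<tau> permutes ?K. signof \<tau> * (\<Prod>i\<in>?K. submatrix A I I $$ (i, \<tau> i)))"
    using sub by (simp add: det_def)
  also have "\<dots> = (\<Sum>\<sigma> | \<sigma> permutes I. signof \<sigma> * (\<Prod>i\<in>I. A $$ (i, \<sigma> i)))"
  proof (rule sum.reindex_bij_witness[of _ "map_permutation I (inv_into ?K (pick I))"
        "map_permutation ?K (pick I)"])
    fix \<tau> assume "\<tau> \<in> {\<tau>. \<tau> permutes ?K}"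
    then have t: "\<tau> permutes ?K" by simp
    show "map_permutation I (inv_into ?K (pick I)) (map_permutation ?K (pick I) \<tau>) = \<tau>"
      by (rule map_permutation_compose_inv[OF bij t bij_betw_inv_into_left[OF bij]])
    show "map_permutation ?K (pick I) \<tau> \<in> {\<sigma>. \<sigma> permutes I}"
      using map_permutation_permutes[OF bij t] by simp
    have "(\<Prod>i\<in>?K. submatrix A I I $$ (i, \<tau> i)) = (\<Prod>i\<in>?K. A $$ (pick I i, pick I (\<tau> i)))"
    proof (rule prod.cong[OF refl])
      fix i assume i: "i \<in> ?K"
      then have "\<tau> i \<in> ?K" using t permutes_in_image by metis
      then show "submatrix A I I $$ (i, \<tau> i) = A $$ (pick I i, pick I (\<tau> i))"
        using i A by (intro submatrix_index) (auto simp: eqI)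
    qed
    also have "\<dots> = (\<Prod>i\<in>?K. A $$ (pick I i, map_permutation ?K (pick I) \<tau> (pick I i)))"
      using inj by (intro prod.cong) (auto simp: map_permutation_apply)
    also have "\<dots> = (\<Prod>i\<in>I. A $$ (i, map_permutation ?K (pick I) \<tau> i))"
      by (rule prod.reindex_bij_betw[OF bij])
    finally show "signof (map_permutation ?K (pick I) \<tau>) *
        (\<Prod>i\<in>I. A $$ (i, map_permutation ?K (pick I) \<tau> i)) =
        signof \<tau> * (\<Prod>i\<in>?K. submatrix A I I $$ (i, \<tau> i))"
      using sign_map_permutation[OF inj t] by simp
  next
    fix \<sigma> assume "\<sigma> \<in> {\<sigma>. \<sigma> permutes I}"
    then have s: "\<sigma> permutes I" by simp
    show "map_permutation ?K (pick I) (map_permutation I (inv_into ?K (pick I)) \<sigma>) = \<sigma>"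
      by (rule map_permutation_compose_inv[OF bij' s bij_betw_inv_into_right[OF bij]])
    show "map_permutation I (inv_into ?K (pick I)) \<sigma> \<in> {\<tau>. \<tau> permutes ?K}"
      using map_permutation_permutes[OF bij' s] by simp
  qed
  finally show ?thesis .
qed

lemma minus_one_power_eq_monom: "(- 1 :: 'a :: comm_ring_1 poly) ^ k = monom ((- 1) ^ k) 0"
proof -
  have "(- 1 :: 'a poly) = monom (- 1) 0" by (simp add: monom_0 one_pCons)
  then show ?thesis by (simp add: monom_power)
qed

text \<open>
  In the product of the entries \<open>(i, \<sigma> i)\<close> of the characteristic matrix, expand every factor and
  sort by the set \<open>I\<close> of rows in which the entry of \<open>A\<close> was chosen.  The remaining rows contribute a
  power of the variable if \<open>\<sigma>\<close> fixes them all, that is, if \<open>\<sigma>\<close> permutes \<open>I\<close>, and zero otherwise.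
  Summing over these \<open>\<sigma>\<close> gives the principal minor of \<open>I\<close>.
\<close>

lemma char_poly_principal_minors:
  fixes A :: "'a :: comm_ring_1 mat"
  assumes A: "A \<in> carrier_mat n n"
  shows "char_poly A =
    (\<Sum>I\<in>Pow {0..<n}. monom ((- 1) ^ card I * det (submatrix A I I)) (n - card I))"
proof -
  let ?N = "{0..<n}"
  let ?S = "{\<sigma>. \<sigma> permutes ?N}"
  define c where "c I \<sigma> = (- 1) ^ card I * (signof \<sigma> * (\<Prod>i\<in>I. A $$ (i, \<sigma> i)))" for I and \<sigma> :: "nat \<Rightarrow> nat"
  have expand: "signof \<sigma> * (\<Prod>i\<in>?N. char_poly_matrix A $$ (i, \<sigma> i)) =
      (\<Sum>I\<in>Pow ?N. if \<sigma> permutes I then monom (c I \<sigma>) (n - card I) else 0)"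
    if s: "\<sigma> \<in> ?S" for \<sigma>
  proof -
    have "(\<Prod>i\<in>?N. char_poly_matrix A $$ (i, \<sigma> i)) =
        (\<Prod>i\<in>?N. (if \<sigma> i = i then monom 1 1 else 0) - monom (A $$ (i, \<sigma> i)) 0)"
    proof (rule prod.cong[OF refl])
      fix i assume i: "i \<in> ?N"
      then have "\<sigma> i < n" using s permutes_in_image[of \<sigma> ?N i] by simp
      then show "char_poly_matrix A $$ (i, \<sigma> i) =
          (if \<sigma> i = i then monom 1 1 else 0) - monom (A $$ (i, \<sigma> i)) 0"
        using i A by (auto simp: char_poly_matrix_def monom_0 monom_Suc)
    qed
    also have "\<dots> = (\<Sum>I\<in>Pow ?N. (- 1) ^ card I * (\<Prod>i\<in>I. monom (A $$ (i, \<sigma> i)) 0) *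
        (\<Prod>i\<in>?N - I. if \<sigma> i = i then monom 1 1 else 0))"
      by (rule prod_diff_conv_sum) simp
    also have "signof \<sigma> * \<dots> = (\<Sum>I\<in>Pow ?N. if \<sigma> permutes I then monom (c I \<sigma>) (n - card I) else 0)"
      unfolding sum_distrib_left
    proof (rule sum.cong[OF refl])
      fix I assume "I \<in> Pow ?N"
      then have I: "I \<subseteq> ?N" by simp
      then have finI: "finite I" by (rule finite_subset) simp
      have fixes_iff: "\<sigma> permutes I \<longleftrightarrow> (\<forall>i\<in>?N - I. \<sigma> i = i)"
        using s permutes_superset[of \<sigma> ?N I] permutes_not_in[of \<sigma> I] by auto
      have lin: "(\<Prod>i\<in>?N - I. if \<sigma> i = i then monom 1 1 else 0 :: 'a poly) =
          (if \<sigma> permutes I then monom 1 (n - card I) else 0)"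
      proof (cases "\<sigma> permutes I")
        case True
        then have "(\<Prod>i\<in>?N - I. if \<sigma> i = i then monom 1 1 else 0 :: 'a poly) = (\<Prod>i\<in>?N - I. monom 1 1)"
          by (intro prod.cong) (auto simp: fixes_iff)
        also have "\<dots> = monom 1 (card (?N - I))" by (simp add: monom_power)
        finally show ?thesis using True I finI by (simp add: card_Diff_subset)
      next
        case False
        then obtain i where "i \<in> ?N - I" "\<sigma> i \<noteq> i" using fixes_iff by blast
        then show ?thesis using False by (simp, intro prod_zero) auto
      qed
      have const: "(\<Prod>i\<in>I. monom (A $$ (i, \<sigma> i)) 0) = monom (\<Prod>i\<in>I. A $$ (i, \<sigma> i)) 0"
        using finI by (induction I) (simp_all add: mult_monom)
      note one = minus_one_power_eq_monom[of "card I", where 'a = 'a]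
      have sgn: "signof \<sigma> = (monom (signof \<sigma>) 0 :: 'a poly)"
        by (cases \<sigma> rule: sign_cases) (simp_all add: monom_0 one_pCons)
      show "signof \<sigma> * ((- 1) ^ card I * (\<Prod>i\<in>I. monom (A $$ (i, \<sigma> i)) 0) *
          (\<Prod>i\<in>?N - I. if \<sigma> i = i then monom 1 1 else 0)) =
          (if \<sigma> permutes I then monom (c I \<sigma>) (n - card I) else 0)"
        unfolding lin const one sgn c_def by (simp add: mult_monom mult_ac)
    qed
    finally show ?thesis .
  qed
  have "char_poly A = (\<Sum>\<sigma>\<in>?S. signof \<sigma> * (\<Prod>i\<in>?N. char_poly_matrix A $$ (i, \<sigma> i)))"
    using A by (simp add: char_poly_def det_def char_poly_matrix_def)
  also have "\<dots> = (\<Sum>\<sigma>\<in>?S. \<Sum>I\<in>Pow ?N. if \<sigma> permutes I then monom (c I \<sigma>) (n - card I) else 0)"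
    by (rule sum.cong[OF refl expand])
  also have "\<dots> = (\<Sum>I\<in>Pow ?N. \<Sum>\<sigma>\<in>?S. if \<sigma> permutes I then monom (c I \<sigma>) (n - card I) else 0)"
    by (rule sum.swap)
  also have "\<dots> = (\<Sum>I\<in>Pow ?N. monom ((- 1) ^ card I * det (submatrix A I I)) (n - card I))"
  proof (rule sum.cong[OF refl])
    fix I assume "I \<in> Pow ?N"
    then have I: "I \<subseteq> ?N" by simp
    have eq: "{\<sigma> \<in> ?S. \<sigma> permutes I} = {\<sigma>. \<sigma> permutes I}"
      using permutes_subset[OF _ I] by auto
    have "(\<Sum>\<sigma>\<in>?S. if \<sigma> permutes I then monom (c I \<sigma>) (n - card I) else 0) =
        (\<Sum>\<sigma> | \<sigma> permutes I. monom (c I \<sigma>) (n - card I))"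
      unfolding eq[symmetric] by (rule sum.inter_filter[symmetric]) (simp add: finite_permutations)
    also have "\<dots> = monom (\<Sum>\<sigma> | \<sigma> permutes I. c I \<sigma>) (n - card I)"
      by (rule monom_sum[symmetric])
    also have "(\<Sum>\<sigma> | \<sigma> permutes I. c I \<sigma>) = (- 1) ^ card I * det (submatrix A I I)"
      unfolding det_principal_submatrix[OF A I] c_def sum_distrib_left ..
    finally show "(\<Sum>\<sigma>\<in>?S. if \<sigma> permutes I then monom (c I \<sigma>) (n - card I) else 0) =
        monom ((- 1) ^ card I * det (submatrix A I I)) (n - card I)" .
  qed
  finally show ?thesis .
qed

text \<open>
  The right-hand side has the same shape as the expansion of a characteristic polynomial, with
  products of roots in the place of principal minors, so that both are read off by the next lemma.
\<close>

lemma prod_linear_factors: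
  fixes r :: "'b \<Rightarrow> 'a :: comm_ring_1"
  assumes "finite N"
  shows "(\<Prod>i\<in>N. [:- r i, 1:]) =
    (\<Sum>I\<in>Pow N. monom ((- 1) ^ card I * (\<Prod>i\<in>I. r i)) (card N - card I))"
proof -
  have "(\<Prod>i\<in>N. [:- r i, 1:]) = (\<Prod>i\<in>N. monom 1 1 - monom (r i) 0)"
    by (simp add: monom_0 monom_Suc)
  also have "\<dots> = (\<Sum>I\<in>Pow N. (- 1) ^ card I * (\<Prod>i\<in>I. monom (r i) 0) * (\<Prod>i\<in>N - I. monom 1 1))"
    by (rule prod_diff_conv_sum[OF assms])
  also have "\<dots> = (\<Sum>I\<in>Pow N. monom ((- 1) ^ card I * (\<Prod>i\<in>I. r i)) (card N - card I))"
  proof (rule sum.cong[OF refl])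
    fix I assume "I \<in> Pow N"
    then have I: "I \<subseteq> N" "finite I" using assms finite_subset by auto
    have const: "(\<Prod>i\<in>I. monom (r i) 0) = monom (\<Prod>i\<in>I. r i) 0"
      using I(2) by (induction I) (simp_all add: mult_monom)
    note one = minus_one_power_eq_monom[of "card I", where 'a = 'a]
    show "(- 1) ^ card I * (\<Prod>i\<in>I. monom (r i) 0) * (\<Prod>i\<in>N - I. monom 1 1) =
        monom ((- 1) ^ card I * (\<Prod>i\<in>I. r i)) (card N - card I)"
      unfolding const one using I by (simp add: mult_monom monom_power card_Diff_subset)
  qed
  finally show ?thesis .
qed

lemma coeff_sum_monom_Pow:
  fixes c :: "'b set \<Rightarrow> 'a :: comm_ring_1"
  assumes "finite N" "k \<le> card N"
  shows "coeff (\<Sum>I\<in>Pow N. monom ((- 1) ^ card I * c I) (card N - card I)) (card N - k) =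
    (- 1) ^ k * (\<Sum>I | I \<subseteq> N \<and> card I = k. c I)"
proof -
  have "coeff (\<Sum>I\<in>Pow N. monom ((- 1) ^ card I * c I) (card N - card I)) (card N - k) =
      (\<Sum>I\<in>Pow N. if card I = k then (- 1) ^ k * c I else 0)"
    unfolding coeff_sum
  proof (rule sum.cong[OF refl])
    fix I assume "I \<in> Pow N"
    then have "card I \<le> card N" using assms(1) card_mono by auto
    then show "coeff (monom ((- 1) ^ card I * c I) (card N - card I)) (card N - k) =
        (if card I = k then (- 1) ^ k * c I else 0)"
      using assms(2) by auto
  qed
  also have "\<dots> = (\<Sum>I | I \<in> Pow N \<and> card I = k. (- 1) ^ k * c I)"
    by (rule sum.inter_filter[symmetric]) (use assms(1) in simp)
  finally show ?thesis by (simp add: sum_distrib_left)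
qed

lemma prod_linear_factors_eqI:
  fixes p :: "'a :: idom poly" and r :: "'b \<Rightarrow> 'a"
  assumes p: "degree p = card N" "lead_coeff p = 1"
    and N: "finite N" "inj_on r N" "\<And>i. i \<in> N \<Longrightarrow> poly p (r i) = 0"
  shows "p = (\<Prod>i\<in>N. [:- r i, 1:])"
proof (rule poly_eqI_degree_lead_coeff[where n = "card N" and A = "r ` N"])
  have deg: "degree (\<Prod>i\<in>N. [:- r i, 1:]) = card N"
    by (subst degree_prod_sum_eq) auto
  have "lead_coeff (\<Prod>i\<in>N. [:- r i, 1:]) = 1" by (simp add: lead_coeff_prod)
  then show "coeff p (card N) = coeff (\<Prod>i\<in>N. [:- r i, 1:]) (card N)"
    using p by (simp add: deg)
  show "degree (\<Prod>i\<in>N. [:- r i, 1:]) \<le> card N" by (simp add: deg)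
  show "card N \<le> card (r ` N)" using N(2) by (simp add: card_image)
  fix z assume "z \<in> r ` N"
  then show "poly p z = poly (\<Prod>i\<in>N. [:- r i, 1:]) z"
    using N(1,3) by (auto simp: poly_prod intro!: prod_zero)
qed (use p in simp)

lemma coeff_signed_char_poly:
  fixes \<alpha> :: "nat \<Rightarrow> 'a :: comm_ring_1"
  assumes "\<alpha> 0 = 1" "k \<le> n"
  shows "coeff (monom 1 n + (\<Sum>i<n. monom ((- 1) ^ (n - i) * \<alpha> (n - i)) i)) (n - k) = (- 1) ^ k * \<alpha> k"
proof (cases "k = 0")
  case True
  then show ?thesis using assms(1) by (simp add: coeff_sum)
next
  case False
  have "coeff (\<Sum>i<n. monom ((- 1) ^ (n - i) * \<alpha> (n - i)) i) (n - k) =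
      (\<Sum>i<n. if i = n - k then (- 1) ^ k * \<alpha> k else 0)"
    unfolding coeff_sum by (rule sum.cong) (use assms(2) in auto)
  then show ?thesis using False assms(2) by simp
qed

section \<open>Principal minors and eigenvalues of totally positive matrices\<close>

lemma map_mat_submatrix: "map_mat f (submatrix A I J) = submatrix (map_mat f A) I J"
  by (rule eq_matI) (auto simp: dim_submatrix submatrix_index pick_le)

lemma submatrix_carrier:
  assumes "A \<in> carrier_mat n n" "I \<subseteq> {0..<n}"
  shows "submatrix A I I \<in> carrier_mat (card I) (card I)"
proof -
  have "{i. i < n \<and> i \<in> I} = I" using assms(2) by auto
  then show ?thesis using assms(1) by (intro carrier_matI) (simp_all add: dim_submatrix)
qed

lemma TP_entry_pos:
  assumes "TP A" "i < dim_row A" "j < dim_col A"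
  shows "0 < A $$ (i, j)"
proof -
  have eq: "{k. k < dim_row A \<and> k \<in> {i}} = {i}" "{k. k < dim_col A \<and> k \<in> {j}} = {j}"
    using assms by auto
  have "submatrix A {i} {j} \<in> carrier_mat 1 1"
    by (intro carrier_matI) (simp_all only: dim_submatrix eq card_1_singleton_iff, auto)
  then have "det (submatrix A {i} {j}) = submatrix A {i} {j} $$ (0, 0)" by (rule det_single)
  also have "\<dots> = A $$ (i, j)"
  proof -
    have "{a \<in> {i}. a < i} = {}" "{a \<in> {j}. a < j} = {}" by auto
    then show ?thesis
      using submatrix_index_card[of i A j "{i}" "{j}"] assms by (simp only: card.empty singletonI)
  qed
  finally show ?thesis
    using assms(1)[unfolded TP_def, rule_format, of "{i}" "{j}"] assms(2,3) by simp
qed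

lemma TP_principal_minor_pos:
  assumes "TP A" "A \<in> carrier_mat n n" "I \<subseteq> {0..<n}"
  shows "0 < det (submatrix A I I)"
  using assms unfolding TP_def by auto

text \<open>
  At \<open>x = - y\<close> with \<open>y \<ge> 0\<close> all nonzero terms of the expansion into principal minors have the
  sign \<open>(- 1) ^ n\<close>, and the constant term, which is the full determinant, is one of them; so \<open>x\<close> is not
  a root.
\<close>

lemma TP_eigenvalue_pos:
  assumes TP: "TP A" and A: "A \<in> carrier_mat n n" and ev: "eigenvalue A x"
  shows "0 < x"
proof (rule ccontr)
  assume "\<not> 0 < x"
  then have y: "0 \<le> - x" by simp
  let ?S = "\<Sum>I\<in>Pow {0..<n}. det (submatrix A I I) * (- x) ^ (n - card I)"
  have "poly (char_poly A) x =
      (\<Sum>I\<in>Pow {0..<n}. (- 1) ^ card I * det (submatrix A I I) * x ^ (n - card I))"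
    by (simp add: char_poly_principal_minors[OF A] poly_sum poly_monom)
  also have "\<dots> = (\<Sum>I\<in>Pow {0..<n}. (- 1) ^ n * (det (submatrix A I I) * (- x) ^ (n - card I)))"
  proof (rule sum.cong[OF refl])
    fix I assume "I \<in> Pow {0..<n}"
    then have "card I \<le> n" using card_mono[of "{0..<n}" I] by simp
    then have "(- 1) ^ n = (- 1) ^ card I * (- 1 :: 'a) ^ (n - card I)" by (simp flip: power_add)
    then show "(- 1) ^ card I * det (submatrix A I I) * x ^ (n - card I) =
        (- 1) ^ n * (det (submatrix A I I) * (- x) ^ (n - card I))"
      by (subst power_minus) simp
  qed
  also have "\<dots> = (- 1) ^ n * ?S" by (rule sum_distrib_left[symmetric])
  finally have "?S = 0" using ev eigenvalue_root_char_poly[OF A] by simp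
  moreover have "0 < det (submatrix A {0..<n} {0..<n}) * (- x) ^ (n - card {0..<n})"
    using TP_principal_minor_pos[OF TP A] by simp
  moreover have "\<dots> \<le> ?S"
  proof (rule member_le_sum)
    fix I assume "I \<in> Pow {0..<n} - {{0..<n}}"
    then show "0 \<le> det (submatrix A I I) * (- x) ^ (n - card I)"
      using TP_principal_minor_pos[OF TP A] y by (intro mult_nonneg_nonneg zero_le_power) (auto intro: less_imp_le)
  qed auto
  ultimately show False by simp
qed

lemma val_principal_minor:
  assumes A: "A \<in> carrier_mat n n" and TP: "TP A" and trop: "trop_TP (map_mat val A)"
    and I: "I \<subseteq> {0..<n}"
  shows "val (det (submatrix A I I)) = trop_per (submatrix (map_mat val A) I I)"
  unfolding map_mat_submatrix[symmetric]
proof (rule val_det_eq_trop_per[OF submatrix_carrier[OF A I]])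
  have eqI: "{i. i < n \<and> i \<in> I} = I" using I by auto
  fix i j assume "i < card I" "j < card I"
  then show "0 < submatrix A I I $$ (i, j)"
    using A pick_le[of i n I] pick_le[of j n I] TP_entry_pos[OF TP]
    by (subst submatrix_index) (simp_all add: eqI)
next
  fix \<sigma> assume "\<sigma> permutes {0..<card I}"
    "trop_weight (map_mat val (submatrix A I I)) \<sigma> = trop_per (map_mat val (submatrix A I I))"
  then show "evenperm \<sigma>"
    using trop A I unfolding trop_TP_def map_mat_submatrix by auto
qed

section \<open>Elementary symmetric polynomials of positive series\<close>

text \<open>
  Exchange the elements of \<open>I\<close> beyond \<open>k\<close>, whose values are at most \<open>v k\<close>, for the equally many
  missing elements of the initial segment, whose values are at least \<open>v k\<close>.
\<close>

lemma sum_le_sum_initial_segment: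
  fixes v :: "nat \<Rightarrow> real"
  assumes anti: "\<And>i j. 1 \<le> i \<Longrightarrow> i \<le> j \<Longrightarrow> j \<le> n \<Longrightarrow> v j \<le> v i"
    and I: "I \<subseteq> {1..n}" "card I = k"
  shows "(\<Sum>i\<in>I. v i) \<le> (\<Sum>i\<in>{1..k}. v i)"
proof -
  have fin: "finite I" using I(1) by (rule finite_subset) simp
  have kn: "k \<le> n" using card_mono[OF _ I(1)] I(2) by simp
  let ?K = "{1..k}"
  have cards: "card (I - ?K) = card (?K - I)"
    using card_Diff_subset_Int[of I ?K] card_Diff_subset_Int[of ?K I] fin I(2)
    by (simp add: Int_commute)
  have "(\<Sum>i\<in>I - ?K. v i) \<le> of_nat (card (I - ?K)) * v k"
  proof (rule sum_bounded_above)
    fix i assume i: "i \<in> I - ?K"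
    then have "I \<noteq> {}" by auto
    then have "1 \<le> k" using fin by (simp add: Suc_le_eq card_gt_0_iff flip: I(2))
    then show "v i \<le> v k" using i I(1) by (intro anti) auto
  qed
  also have "\<dots> \<le> (\<Sum>i\<in>?K - I. v i)"
    unfolding cards by (rule sum_bounded_below) (use kn in \<open>auto intro: anti\<close>)
  finally have le: "(\<Sum>i\<in>I - ?K. v i) \<le> (\<Sum>i\<in>?K - I. v i)" .
  have "(\<Sum>i\<in>I. v i) = (\<Sum>i\<in>I \<inter> ?K. v i) + (\<Sum>i\<in>I - ?K. v i)"
    by (rule sum.Int_Diff[OF fin])
  moreover have "(\<Sum>i\<in>?K. v i) = (\<Sum>i\<in>?K \<inter> I. v i) + (\<Sum>i\<in>?K - I. v i)"
    by (rule sum.Int_Diff) simp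
  ultimately show ?thesis using le by (simp add: Int_commute)
qed

text \<open>
  The elementary symmetric polynomials of positive series do not cancel; their dominant monomial is
  the product of the \<open>k\<close> roots of largest valuation.
\<close>

lemma val_elem_sym:
  fixes \<rho> :: "nat \<Rightarrow> puiseux"
  assumes v: "\<And>i. i \<in> {1..n} \<Longrightarrow> val (\<rho> i) = ereal (v i)"
    and pos: "\<And>i. i \<in> {1..n} \<Longrightarrow> 0 < \<rho> i"
    and anti: "\<And>i j. 1 \<le> i \<Longrightarrow> i \<le> j \<Longrightarrow> j \<le> n \<Longrightarrow> v j \<le> v i"
    and k: "k \<le> n"
  shows "val (\<Sum>I | I \<subseteq> {1..n} \<and> card I = k. \<Prod>i\<in>I. \<rho> i) = ereal (\<Sum>i\<in>{1..k}. v i)"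
proof -
  let ?S = "{I. I \<subseteq> {1..n} \<and> card I = k}"
  have fin: "finite ?S" by (rule finite_subset[of _ "Pow {1..n}"]) auto
  have initial: "{1..k} \<in> ?S" using k by auto
  have val: "val (\<Prod>i\<in>I. \<rho> i) = ereal (\<Sum>i\<in>I. v i)" if "I \<in> ?S" for I
  proof -
    have "(\<Sum>i\<in>I. val (\<rho> i)) = (\<Sum>i\<in>I. ereal (v i))"
      by (rule sum.cong[OF refl], rule v) (use that in auto)
    then show ?thesis by (simp add: val_prod)
  qed
  have "val (\<Sum>I\<in>?S. \<Prod>i\<in>I. \<rho> i) = Max ((\<lambda>I. val (\<Prod>i\<in>I. \<rho> i)) ` ?S)"
  proof (rule val_sum_nonneg[OF fin])
    fix I assume "I \<in> ?S"
    then show "0 \<le> (\<Prod>i\<in>I. \<rho> i)" by (intro prod_nonneg less_imp_le pos) auto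
  qed (use initial in blast)
  also have "\<dots> = ereal (\<Sum>i\<in>{1..k}. v i)"
  proof (rule Max_eqI)
    fix y assume "y \<in> (\<lambda>I. val (\<Prod>i\<in>I. \<rho> i)) ` ?S"
    then obtain I where "I \<in> ?S" "y = val (\<Prod>i\<in>I. \<rho> i)" by blast
    then show "y \<le> ereal (\<Sum>i\<in>{1..k}. v i)"
      using sum_le_sum_initial_segment[OF anti] val by simp
  next
    show "ereal (\<Sum>i\<in>{1..k}. v i) \<in> (\<lambda>I. val (\<Prod>i\<in>I. \<rho> i)) ` ?S"
      using initial val[OF initial] by (metis (no_types, lifting) image_eqI)
  qed (use fin in simp)
  finally show ?thesis .
qed

section \<open>Tropical characteristic polynomials that split\<close>

text \<open>
  Both sequences list the same multiset in decreasing order.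
\<close>

lemma antimono_eq_of_level_cards:
  fixes f g :: "nat \<Rightarrow> 'a :: linorder"
  assumes f: "\<And>i j. 1 \<le> i \<Longrightarrow> i \<le> j \<Longrightarrow> j \<le> n \<Longrightarrow> f j \<le> f i"
    and g: "\<And>i j. 1 \<le> i \<Longrightarrow> i \<le> j \<Longrightarrow> j \<le> n \<Longrightarrow> g j \<le> g i"
    and eq: "\<And>x. card {i \<in> {1..n}. f i = x} = card {i \<in> {1..n}. g i = x}"
    and i: "i \<in> {1..n}"
  shows "f i = g i"
proof -
  have sorted: "sorted (rev (map h [1..<Suc n]))"
    if "\<And>i j. 1 \<le> i \<Longrightarrow> i \<le> j \<Longrightarrow> j \<le> n \<Longrightarrow> h j \<le> h i" for h :: "nat \<Rightarrow> 'a"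
    unfolding sorted_rev_iff_nth_mono using that by (auto simp del: upt_Suc)
  have count: "count (mset (rev (map h xs))) x = card {i \<in> set xs. h i = x}"
    if "distinct xs" for h :: "nat \<Rightarrow> 'a" and x xs
    using that
  proof (induction xs)
    case (Cons y xs)
    have "{i \<in> set (y # xs). h i = x} = (if h y = x then insert y else id) {i \<in> set xs. h i = x}"
      by auto
    then show ?case using Cons by simp
  qed simp
  have set_upt: "set [1..<Suc n] = {1..n}" by auto
  have mset_eq: "mset (rev (map f [1..<Suc n])) = mset (rev (map g [1..<Suc n]))"
    by (rule multiset_eqI) (simp only: count[OF distinct_upt] set_upt eq)
  have sf: "sorted (rev (map f [1..<Suc n]))" by (rule sorted) (rule f)
  have sg: "sorted (rev (map g [1..<Suc n]))" by (rule sorted) (rule g)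
  have "rev (map f [1..<Suc n]) = rev (map g [1..<Suc n])"
    using properties_for_sort[OF mset_eq sf] sorted_sort_id[OF sg] by (simp only:)
  then show ?thesis using i by (simp del: upt_Suc)
qed

text \<open>
  One-sided derivatives are unique as limits of difference quotients.
\<close>

lemma the_deriv_eq:
  assumes "(f has_real_derivative D) (at x within S)" "at x within S \<noteq> bot"
  shows "the_deriv f (at x within S) = D"
  unfolding the_deriv_def
proof (rule the_equality)
  show "(f has_real_derivative D) (at x within S)" by (rule assms(1))
  fix E assume "(f has_real_derivative E) (at x within S)"
  then show "E = D"
    using assms tendsto_unique unfolding has_field_derivative_iff by blast
qed

lemma max_right_derivative:
  fixes c x :: real
  shows "((\<lambda>t. max t c) has_real_derivative of_bool (c \<le> x)) (at_right x)"
  unfolding has_field_derivative_iff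
proof (rule tendsto_eventually)
  show "\<forall>\<^sub>F y in at_right x. (max y c - max x c) / (y - x) = of_bool (c \<le> x)"
    unfolding eventually_at_right_field
    \<comment> \<open>Between \<open>x\<close> and the witness the maximum is affine.\<close>
    by (rule exI[of _ "if c \<le> x then x + 1 else c"]) (auto simp: max_def)
qed

lemma max_left_derivative:
  fixes c x :: real
  shows "((\<lambda>t. max t c) has_real_derivative of_bool (c < x)) (at_left x)"
  unfolding has_field_derivative_iff
proof (rule tendsto_eventually)
  show "\<forall>\<^sub>F y in at_left x. (max y c - max x c) / (y - x) = of_bool (c < x)"
    unfolding eventually_at_left_field
    by (rule exI[of _ "if c < x then c else x - 1"]) (auto simp: max_def)
qed

text \<open>
  Partial sums of a decreasing sequence \<open>v\<close> are concave in \<open>k\<close>.  A tropical characteristic polynomial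
  with such coefficients splits into the tropical linear factors \<open>max x (v i)\<close>.
\<close>

locale split_trop_matrix =
  fixes B :: "ereal mat" and n :: nat and v :: "nat \<Rightarrow> real"
  assumes B: "B \<in> carrier_mat n n"
    and anti: "\<And>i j. 1 \<le> i \<Longrightarrow> i \<le> j \<Longrightarrow> j \<le> n \<Longrightarrow> v j \<le> v i"
    and coeff: "\<And>k. k \<le> n \<Longrightarrow> trop_coeff B k = ereal (\<Sum>i\<in>{1..k}. v i)"
begin

lemma term_eq:
  assumes "k \<le> n"
  shows "trop_term B (n - k) (ereal x) = ereal ((\<Sum>i\<in>{1..k}. v i) + (\<Sum>i\<in>{k<..n}. x))"
  using assms B by (simp add: trop_term_def coeff)

lemma split_sum:
  fixes h :: "nat \<Rightarrow> real"
  assumes "k \<le> n"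
  shows "(\<Sum>i\<in>{1..n}. h i) = (\<Sum>i\<in>{1..k}. h i) + (\<Sum>i\<in>{k<..n}. h i)"
proof -
  have "{1..n} = {1..k} \<union> {k<..n}" using assms by auto
  moreover have "sum h ({1..k} \<union> {k<..n}) = sum h {1..k} + sum h {k<..n}"
    by (rule sum.union_disjoint) auto
  ultimately show ?thesis by simp
qed

text \<open>
  In the tropical product of the linear factors, \<open>trop_term B (n - k)\<close> arises by choosing \<open>v i\<close> for
  \<open>i \<le> k\<close> and \<open>x\<close> for \<open>i > k\<close>; the next lemma says when these are the larger choices.
\<close>

lemma term_le:
  assumes "k \<le> n"
  shows "trop_term B (n - k) (ereal x) \<le> ereal (\<Sum>i\<in>{1..n}. max x (v i))"
  unfolding term_eq[OF assms] split_sum[OF assms] ereal_less_eq by (intro add_mono sum_mono) auto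

lemma term_attains:
  assumes "k \<le> n" "\<And>i. 1 \<le> i \<Longrightarrow> i \<le> k \<Longrightarrow> x \<le> v i" "\<And>i. k < i \<Longrightarrow> i \<le> n \<Longrightarrow> v i \<le> x"
  shows "trop_term B (n - k) (ereal x) = ereal (\<Sum>i\<in>{1..n}. max x (v i))"
  unfolding term_eq[OF assms(1)] split_sum[OF assms(1)]
  using assms(2,3) by (intro arg_cong[of _ _ ereal] arg_cong2[of _ _ _ _ "(+)"] sum.cong) (auto simp: max_def antisym)

text \<open>
  A maximal term is the one whose index \<open>m\<close> separates the \<open>v i\<close> above \<open>x\<close> from those below.
\<close>

lemma char_poly_eq: "trop_char_poly B (ereal x) = ereal (\<Sum>i\<in>{1..n}. max x (v i))"
proof -
  define K where "K = {k \<in> {0..n}. \<forall>i\<in>{1..k}. x \<le> v i}"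
  define m where "m = Max K"
  have K: "finite K" "0 \<in> K" by (auto simp: K_def)
  then have m: "m \<in> K" unfolding m_def by (intro Max_in) auto
  have below: "v i \<le> x" if i: "m < i" "i \<le> n" for i
  proof (rule ccontr)
    assume "\<not> v i \<le> x"
    then have "i \<in> K" unfolding K_def using i(2) anti[of _ i] by fastforce
    then have "i \<le> m" unfolding m_def using K(1) by simp
    then show False using i(1) by simp
  qed
  have att: "trop_term B (n - m) (ereal x) = ereal (\<Sum>i\<in>{1..n}. max x (v i))"
    by (rule term_attains) (use m below in \<open>auto simp: K_def\<close>)
  show ?thesis unfolding trop_char_poly_eq_Max[OF B PInfty_neq_ereal(1)]
  proof (rule Max_eqI)
    fix y assume "y \<in> (\<lambda>i. trop_term B i (ereal x)) ` {0..n}"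
    then obtain i where i: "i \<le> n" "y = trop_term B i (ereal x)" by auto
    then show "y \<le> ereal (\<Sum>i\<in>{1..n}. max x (v i))" using term_le[of "n - i" x] by simp
  next
    show "ereal (\<Sum>i\<in>{1..n}. max x (v i)) \<in> (\<lambda>i. trop_term B i (ereal x)) ` {0..n}"
      unfolding att[symmetric] by auto
  qed simp
qed

text \<open>
  At \<open>x = v i\<close> both choices for the \<open>i\<close>-th linear factor agree, so two consecutive terms are maximal.
\<close>

lemma v_eigenvalue:
  assumes i: "i \<in> {1..n}"
  shows "trop_eigenvalue B (ereal (v i))"
proof -
  have "trop_term B (n - i) (ereal (v i)) = trop_char_poly B (ereal (v i))"
    unfolding char_poly_eq by (rule term_attains) (use i anti in auto)
  moreover have "trop_term B (n - (i - 1)) (ereal (v i)) = trop_char_poly B (ereal (v i))"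
    unfolding char_poly_eq by (rule term_attains) (use i anti in auto)
  moreover have "n - i \<le> n" "n - (i - 1) \<le> n" "n - i \<noteq> n - (i - 1)" using i by auto
  ultimately show ?thesis
    unfolding trop_eigenvalue_def using B by (metis PInfty_neq_ereal(1) carrier_matD(1))
qed

text \<open>
  The constant term is real, whereas every other term is \<open>-\<infinity>\<close> at \<open>-\<infinity>\<close>.
\<close>

lemma MInfty_not_eigenvalue: "\<not> trop_eigenvalue B (-\<infinity>)"
proof
  assume "trop_eigenvalue B (-\<infinity>)"
  then obtain i j where ij: "i \<le> n" "j \<le> n" "i \<noteq> j"
    "trop_term B i (-\<infinity>) = trop_char_poly B (-\<infinity>)" "trop_term B j (-\<infinity>) = trop_char_poly B (-\<infinity>)"
    using B by (auto simp: trop_eigenvalue_def)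
  have pos: "trop_term B k (-\<infinity>) = -\<infinity>" if "0 < k" "k \<le> n" for k
    using that B by (simp add: trop_term_def coeff)
  have "trop_term B 0 (-\<infinity>) \<le> trop_char_poly B (-\<infinity>)"
    by (subst trop_char_poly_eq_Max[OF B]) (auto intro!: Max_ge)
  moreover have "trop_term B 0 (-\<infinity>) = ereal (\<Sum>i\<in>{1..n}. v i)"
    using B coeff[of n] by (simp add: trop_term_def zero_ereal_def[symmetric])
  moreover have "trop_char_poly B (-\<infinity>) = -\<infinity>"
    using ij pos[of i] pos[of j] by (cases "i = 0") auto
  ultimately show False by simp
qed

text \<open>
  The slope of \<open>max t (v i)\<close> jumps by one at \<open>v i\<close> and nowhere else.
\<close>

lemma multiplicity_eq: "trop_multiplicity B (ereal x) = card {i \<in> {1..n}. v i = x}"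
proof -
  define f where "f t = (\<Sum>i\<in>{1..n}. max t (v i))" for t
  have f: "(\<lambda>t. real_of_ereal (trop_char_poly B (ereal t))) = f"
    by (simp add: char_poly_eq f_def[abs_def])
  have "(f has_real_derivative (\<Sum>i\<in>{1..n}. of_bool (v i \<le> x))) (at_right x)"
    unfolding f_def by (intro DERIV_sum max_right_derivative)
  then have R: "the_deriv f (at_right x) = (\<Sum>i\<in>{1..n}. of_bool (v i \<le> x))"
    by (rule the_deriv_eq) simp
  have "(f has_real_derivative (\<Sum>i\<in>{1..n}. of_bool (v i < x))) (at_left x)"
    unfolding f_def by (intro DERIV_sum max_left_derivative)
  then have L: "the_deriv f (at_left x) = (\<Sum>i\<in>{1..n}. of_bool (v i < x))"
    by (rule the_deriv_eq) simp
  have "trop_multiplicity B (ereal x) =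
      (\<Sum>i\<in>{1..n}. of_bool (v i \<le> x)) - (\<Sum>i\<in>{1..n}. of_bool (v i < x))"
    by (simp add: trop_multiplicity_def f L R)
  also have "\<dots> = (\<Sum>i\<in>{1..n}. of_bool (v i = x))"
    unfolding sum_subtractf[symmetric] by (rule sum.cong) auto
  finally show ?thesis by (simp add: sum.If_cases of_bool_def Int_def)
qed

text \<open>
  A value that is a tropical eigenvalue occurs in \<open>\<eta>\<close> and in \<open>v\<close> as often as its multiplicity says.
  A value that is not occurs in neither.
\<close>

lemma eigenvalue_list_unique:
  assumes list: "trop_eigenvalue_list B \<eta>" and i: "i \<in> {1..n}"
  shows "\<eta> i = ereal (v i)"
proof (rule antimono_eq_of_level_cards[OF _ _ _ i])
  have dim: "dim_row B = n" using B by simp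
  note list' = list[unfolded trop_eigenvalue_list_def dim]
  show "\<eta> j \<le> \<eta> i" if "1 \<le> i" "i \<le> j" "j \<le> n" for i j using list' that by blast
  show "ereal (v j) \<le> ereal (v i)" if "1 \<le> i" "i \<le> j" "j \<le> n" for i j using anti that by simp
  show "card {i \<in> {1..n}. \<eta> i = x} = card {i \<in> {1..n}. ereal (v i) = x}" for x
  proof (cases "trop_eigenvalue B x")
    case True
    then obtain r where r: "x = ereal r"
      using MInfty_not_eigenvalue by (cases x) (auto simp: trop_eigenvalue_def)
    have "real (card {i \<in> {1..n}. \<eta> i = x}) = trop_multiplicity B x" using list' True by blast
    then show ?thesis unfolding r multiplicity_eq by simp
  next
    case False
    then have "{i \<in> {1..n}. \<eta> i = x} = {}" "{i \<in> {1..n}. ereal (v i) = x} = {}"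
      using list' v_eigenvalue by blast+
    then show ?thesis by (simp only:)
  qed
qed

end

section \<open>Valuations of the coefficients and of the eigenvalues\<close>

theorem proposition6p5:
  fixes n :: nat
    and A :: "puiseux mat"
    and \<alpha> \<rho> :: "nat \<Rightarrow> puiseux"
    and \<eta> :: "nat \<Rightarrow> ereal"
  assumes "A \<in> carrier_mat n n"
    and "TP A"
    and "trop_TP (map_mat val A)"
    and "char_poly A = monom 1 n + (\<Sum>i<n. monom ((-1) ^ (n - i) * \<alpha> (n - i)) i)"
    and "\<alpha> 0 = 1"
    and "{\<rho> i | i. i \<in> {1..n}} = {x. eigenvalue A x}"
    and "\<forall>i j. 1 \<le> i \<longrightarrow> i < j \<longrightarrow> j \<le> n \<longrightarrow> \<rho> i > \<rho> j"
    and "trop_eigenvalue_list (map_mat val A) \<eta>"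
  shows "(\<forall>k \<in> {0..n}. val (\<alpha> k) = trop_coeff (map_mat val A) k) \<and>
         (\<forall>i \<in> {1..n}. val (\<rho> i) = \<eta> i)"
proof -
  let ?B = "map_mat val A"
  note A = assms(1) and TP = assms(2)
  have coeff_\<alpha>: "coeff (char_poly A) (n - k) = (- 1) ^ k * \<alpha> k" if "k \<le> n" for k
    unfolding assms(4) by (rule coeff_signed_char_poly[of \<alpha>, OF assms(5) that])

  have minors: "\<alpha> k = (\<Sum>I | I \<subseteq> {0..<n} \<and> card I = k. det (submatrix A I I))" if "k \<le> n" for k
    using coeff_\<alpha>[OF that] coeff_sum_monom_Pow[of "{0..<n}" k "\<lambda>I. det (submatrix A I I)"] that
    by (simp add: char_poly_principal_minors[OF A])
  have val_\<alpha>: "val (\<alpha> k) = trop_coeff ?B k" if k: "k \<le> n" for k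
  proof -
    let ?S = "{I. I \<subseteq> {0..<n} \<and> card I = k}"
    have fin: "finite ?S" by (rule finite_subset[of _ "Pow {0..<n}"]) auto
    have "{0..<k} \<in> ?S" using k by auto
    then have ne: "?S \<noteq> {}" by blast
    have "val (\<alpha> k) = Max ((\<lambda>I. val (det (submatrix A I I))) ` ?S)"
      unfolding minors[OF k]
      by (rule val_sum_nonneg[OF fin ne]) (auto intro: less_imp_le TP_principal_minor_pos[OF TP A])
    also have "(\<lambda>I. val (det (submatrix A I I))) ` ?S = (\<lambda>I. trop_per (submatrix ?B I I)) ` ?S"
      by (rule image_cong) (auto intro: val_principal_minor[OF A TP assms(3)])
    finally show ?thesis using A by (simp add: trop_coeff_def)
  qed

  have ev: "eigenvalue A (\<rho> i)" if "i \<in> {1..n}" for i using assms(6) that by blast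
  have pos: "0 < \<rho> i" if "i \<in> {1..n}" for i by (rule TP_eigenvalue_pos[OF TP A ev[OF that]])
  define v where "v i = lead_exp (\<rho> i)" for i
  have v: "val (\<rho> i) = ereal (v i)" if "i \<in> {1..n}" for i
    using pos[OF that] by (auto simp: v_def val_def)
  have anti: "v j \<le> v i" if "1 \<le> i" "i \<le> j" "j \<le> n" for i j
  proof -
    have "\<rho> j \<le> \<rho> i" using assms(7) that by (cases "i = j") (auto intro: less_imp_le)
    then have "val (\<rho> j) \<le> val (\<rho> i)" using pos[of j] that by (intro val_mono) auto
    then show ?thesis using v that by simp
  qed
  have inj: "inj_on \<rho> {1..n}"
    by (rule linorder_inj_onI) (use assms(7) in fastforce)+
  have factors: "char_poly A = (\<Prod>i\<in>{1..n}. [:- \<rho> i, 1:])"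
    by (rule prod_linear_factors_eqI)
      (use inj ev degree_monic_char_poly[OF A] eigenvalue_root_char_poly[OF A] in auto)
  have vieta: "\<alpha> k = (\<Sum>I | I \<subseteq> {1..n} \<and> card I = k. \<Prod>i\<in>I. \<rho> i)" if "k \<le> n" for k
    using coeff_\<alpha>[OF that] coeff_sum_monom_Pow[of "{1..n}" k "\<lambda>I. \<Prod>i\<in>I. \<rho> i"] that
    by (simp add: factors prod_linear_factors)
  interpret split_trop_matrix ?B n v
  proof
    show "?B \<in> carrier_mat n n" using A by simp
    show "trop_coeff ?B k = ereal (\<Sum>i\<in>{1..k}. v i)" if "k \<le> n" for k
      using val_\<alpha>[OF that] vieta[OF that] val_elem_sym[OF v pos anti that] by simp
  qed (rule anti)
  show ?thesis
    using val_\<alpha> v eigenvalue_list_unique[OF assms(8)] by simp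
qed

end
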